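(* Let $V=\mathbb{Z}_\ell^{2m}$ with $Q(x_1,\dots,x_m,y_1,\dots,y_m)=\sum_ix_iy_i$, and let $Z,W$ be drawn independently from the canonical probability measure on $\mathrm{OGr}$. Set $S_0:=V\otimes\mathbb{F}_\ell$ and for $j\ge1$ \[S_j:=\Big(\big(\bar W_j\cap\bar Z_j\big)+\ell V/\ell^jV\Big)/\ell V\subset V\otimes\mathbb{F}_\ell,\] where $\bar Z_j,\bar W_j$ are the images of $Z,W$ in $V/\ell^jV$. Then the sequence $S_1,S_2,\dots$ is Markov, and for $i\ge1$ the distribution of $\dim S_{i+1}$ given $S_i$ coincides with the distribution of the dimension of the kernel of a uniformly random alternating bilinear form on $S_i$.
   Context: $\mathrm{OGr}$ is the set of rank $m$ direct summands $Z\subset V$ with $Q|_Z=0$. The canonical probability measure on $\mathrm{OGr}$ is the unique one such that for each $e\ge1$ the image of $Z$ in $V/\ell^eV$ is uniformly distributed among the images of elements of $\mathrm{OGr}$. *)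

theory Defs
  imports
    "HOL-Probability.Probability"
    "HOL-Library.Function_Algebras"
    "HOL-Library.Set_Algebras"
    "Berlekamp_Zassenhaus.Finite_Field"
begin

section \<open>The ring of \<open>\<ell>\<close>-adic integers\<close>

text \<open>
  The prime \<open>\<ell>\<close> is \<open>CARD('p)\<close> for a type \<open>'p\<close> of class \<open>prime_card\<close>, and \<open>'p mod_ring\<close> is the
  field with \<open>\<ell>\<close> elements.  The ring of \<open>\<ell>\<close>-adic integers is the inverse limit of the rings
  \<open>\<int>/\<ell>\<^sup>n\<int>\<close>; the \<open>n\<close>-th entry of a coherent sequence is its reduction modulo \<open>\<ell>\<^sup>n\<close>, taken in
  \<open>{0..<\<ell>\<^sup>n}\<close>.
\<close>

typedef ('p :: prime_card) adic_int =
  "{a :: nat \<Rightarrow> int. \<forall>n. 0 \<le> a n \<and> a n < int CARD('p) ^ n \<and> a (Suc n) mod int CARD('p) ^ n = a n}"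
  morphisms adic_nth Abs_adic_int
  by (rule exI[of _ "\<lambda>_. 0"]) (simp add: prime_gt_0_nat[OF prime_card])

setup_lifting type_definition_adic_int

lemma adic_mod_pow_Suc:
  "(x mod int CARD('p :: prime_card) ^ Suc n) mod int CARD('p) ^ n = x mod int CARD('p) ^ n"
  by (rule mod_mod_cancel) simp

lemma adic_pow_pos: "0 < int CARD('p :: prime_card) ^ n"
  by (simp add: prime_gt_0_nat[OF prime_card])

instantiation adic_int :: (prime_card) comm_ring_1
begin

lift_definition zero_adic_int :: "'a adic_int" is "\<lambda>n. 0 mod int CARD('a) ^ n"
  by (simp add: adic_pow_pos)

lift_definition one_adic_int :: "'a adic_int" is "\<lambda>n. 1 mod int CARD('a) ^ n"
  by (simp add: adic_pow_pos adic_mod_pow_Suc del: power_Suc)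

lift_definition plus_adic_int :: "'a adic_int \<Rightarrow> 'a adic_int \<Rightarrow> 'a adic_int"
  is "\<lambda>a b n. (a n + b n) mod int CARD('a) ^ n"
  by (simp add: adic_pow_pos adic_mod_pow_Suc del: power_Suc) (metis mod_add_eq)

lift_definition minus_adic_int :: "'a adic_int \<Rightarrow> 'a adic_int \<Rightarrow> 'a adic_int"
  is "\<lambda>a b n. (a n - b n) mod int CARD('a) ^ n"
  by (simp add: adic_pow_pos adic_mod_pow_Suc del: power_Suc) (metis mod_diff_eq)

lift_definition uminus_adic_int :: "'a adic_int \<Rightarrow> 'a adic_int"
  is "\<lambda>a n. (- a n) mod int CARD('a) ^ n"
  by (simp add: adic_pow_pos adic_mod_pow_Suc del: power_Suc) (metis mod_minus_eq)

lift_definition times_adic_int :: "'a adic_int \<Rightarrow> 'a adic_int \<Rightarrow> 'a adic_int"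
  is "\<lambda>a b n. (a n * b n) mod int CARD('a) ^ n"
  by (simp add: adic_pow_pos adic_mod_pow_Suc del: power_Suc) (metis mod_mult_eq)

instance
proof
  fix a b c :: "'a adic_int"
  show "a * b * c = a * (b * c)"
    by transfer (simp add: fun_eq_iff mod_simps mult.assoc)
  show "a * b = b * a"
    by transfer (simp add: fun_eq_iff mult.commute)
  show "1 * a = a"
    by transfer (simp add: fun_eq_iff mod_simps)
  show "a + b + c = a + (b + c)"
    by transfer (simp add: fun_eq_iff mod_simps add.assoc)
  show "a + b = b + a"
    by transfer (simp add: fun_eq_iff add.commute)
  show "0 + a = a"
    by transfer (simp add: fun_eq_iff)
  show "- a + a = 0"
    by transfer (simp add: fun_eq_iff mod_simps)
  show "a - b = a + - b"
    by transfer (simp add: fun_eq_iff mod_simps)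
  show "(a + b) * c = a * c + b * c"
    by transfer (simp add: fun_eq_iff mod_simps distrib_right)
  have "(1 :: int) < int CARD('a)"
    using prime_gt_1_nat[OF prime_card, where 'a1 = 'a] by simp
  then have "adic_nth (0 :: 'a adic_int) 1 \<noteq> adic_nth 1 1"
    by (simp add: zero_adic_int.rep_eq one_adic_int.rep_eq)
  then show "(0 :: 'a adic_int) \<noteq> 1"
    by metis
qed

end

definition adic_red :: "'p :: prime_card adic_int \<Rightarrow> 'p mod_ring" where
  "adic_red a = of_int (adic_nth a 1)"

section \<open>Free modules of finite rank\<close>

text \<open>
  \<open>R\<^sup>n\<close> is the set of functions \<open>nat \<Rightarrow> R\<close> that vanish outside \<open>{..<n}\<close>, with pointwise operations.
\<close>

definition coord_space :: "nat \<Rightarrow> (nat \<Rightarrow> 'a :: zero) set" where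
  "coord_space n = {v. \<forall>i\<ge>n. v i = 0}"

definition smul :: "'a :: times \<Rightarrow> (nat \<Rightarrow> 'a) \<Rightarrow> nat \<Rightarrow> 'a" where
  "smul c v = (\<lambda>i. c * v i)"

global_interpretation fmod: Modules.module "smul :: 'a :: comm_ring_1 \<Rightarrow> (nat \<Rightarrow> 'a) \<Rightarrow> nat \<Rightarrow> 'a"
  by unfold_locales (simp_all add: smul_def fun_eq_iff algebra_simps)

global_interpretation fvec: Vector_Spaces.vector_space "smul :: 'a :: field \<Rightarrow> (nat \<Rightarrow> 'a) \<Rightarrow> nat \<Rightarrow> 'a"
  by unfold_locales (simp_all add: smul_def fun_eq_iff algebra_simps)

definition direct_summand :: "(nat \<Rightarrow> 'a :: comm_ring_1) set \<Rightarrow> (nat \<Rightarrow> 'a) set \<Rightarrow> bool" where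
  "direct_summand M N \<longleftrightarrow> fmod.subspace N \<and> N \<subseteq> M \<and>
     (\<exists>N'. fmod.subspace N' \<and> N' \<subseteq> M \<and> N \<inter> N' = {0} \<and> N + N' = M)"

text \<open>Direct summands of \<open>\<int>\<^sub>\<ell>\<^sup>n\<close> are free, so their rank is the cardinality of a basis.\<close>

definition free_of_rank :: "(nat \<Rightarrow> 'a :: comm_ring_1) set \<Rightarrow> nat \<Rightarrow> bool" where
  "free_of_rank N r \<longleftrightarrow> (\<exists>B. finite B \<and> card B = r \<and> \<not> fmod.dependent B \<and> fmod.span B = N)"

section \<open>The orthogonal Grassmannian\<close>

abbreviation V_adic :: "nat \<Rightarrow> (nat \<Rightarrow> 'p :: prime_card adic_int) set" where
  "V_adic m \<equiv> coord_space (2 * m)"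

abbreviation V_mod :: "nat \<Rightarrow> (nat \<Rightarrow> 'p :: prime_card mod_ring) set" where
  "V_mod m \<equiv> coord_space (2 * m)"

text \<open>The coordinates \<open>x\<^sub>1, \<dots>, x\<^sub>m, y\<^sub>1, \<dots>, y\<^sub>m\<close> are \<open>v 0, \<dots>, v (m - 1), v m, \<dots>, v (2 * m - 1)\<close>.\<close>

definition quad_form :: "nat \<Rightarrow> (nat \<Rightarrow> 'p :: prime_card adic_int) \<Rightarrow> 'p adic_int" where
  "quad_form m v = (\<Sum>i<m. v i * v (m + i))"

definition OGr :: "nat \<Rightarrow> (nat \<Rightarrow> 'p :: prime_card adic_int) set set" where
  "OGr m = {Z. direct_summand (V_adic m) Z \<and> free_of_rank Z m \<and> (\<forall>z\<in>Z. quad_form m z = 0)}"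

definition ell_pow_V :: "nat \<Rightarrow> nat \<Rightarrow> (nat \<Rightarrow> 'p :: prime_card adic_int) set" where
  "ell_pow_V m e = smul (of_nat CARD('p) ^ e) ` V_adic m"

text \<open>
  The image of a subset \<open>X\<close> of \<open>V\<close> in \<open>V/\<ell>\<^sup>eV\<close>, as a set of cosets.
\<close>

definition image_mod ::
  "nat \<Rightarrow> nat \<Rightarrow> (nat \<Rightarrow> 'p :: prime_card adic_int) set \<Rightarrow> (nat \<Rightarrow> 'p adic_int) set set" where
  "image_mod m e X = (\<lambda>v. v +o ell_pow_V m e) ` X"

text \<open>
  The Borel \<open>\<sigma>\<close>-algebra of \<open>OGr\<close>: it is generated by the fibres of the maps to the finite sets of
  reductions modulo \<open>\<ell>\<^sup>e\<close>, \<open>e \<ge> 1\<close>.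
\<close>

definition OGr_borel :: "nat \<Rightarrow> (nat \<Rightarrow> 'p :: prime_card adic_int) set measure" where
  "OGr_borel m = sigma (OGr m) {{Z \<in> OGr m. image_mod m e Z = X} | e X. 1 \<le> e}"

definition canonical_OGr_measure ::
  "nat \<Rightarrow> (nat \<Rightarrow> 'p :: prime_card adic_int) set measure \<Rightarrow> bool" where
  "canonical_OGr_measure m M \<longleftrightarrow> prob_space M \<and> sets M = sets (OGr_borel m) \<and>
     (\<forall>e\<ge>1. distr M (count_space (image_mod m e ` OGr m)) (image_mod m e)
              = uniform_count_measure (image_mod m e ` OGr m))"

section \<open>The sequence of subspaces of \<open>V \<otimes> \<bbbF>\<^sub>\<ell>\<close>\<close>

text \<open>
  Sums of cosets, and of sets of cosets, are elementwise (as in \<open>Set_Algebras\<close>).  The union of a set of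
  cosets of \<open>\<ell>\<^sup>jV\<close> is its preimage in \<open>V\<close>, and the coordinatewise map \<open>adic_red\<close> induces the
  identification of \<open>V/\<ell>V\<close> with \<open>V \<otimes> \<bbbF>\<^sub>\<ell>\<close>.
\<close>

definition S_seq :: "nat \<Rightarrow> (nat \<Rightarrow> 'p :: prime_card adic_int) set \<Rightarrow> (nat \<Rightarrow> 'p adic_int) set \<Rightarrow>
    nat \<Rightarrow> (nat \<Rightarrow> 'p mod_ring) set" where
  "S_seq m Z W j = (if j = 0 then V_mod m else
     (\<lambda>v i. adic_red (v i)) `
       \<Union> ((image_mod m j W \<inter> image_mod m j Z) + image_mod m j (ell_pow_V m 1)))"

section \<open>Markov sequences and alternating forms\<close>

definition markov_sequence :: "'w measure \<Rightarrow> 's set \<Rightarrow> (nat \<Rightarrow> 'w \<Rightarrow> 's) \<Rightarrow> bool" where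
  "markov_sequence P T X \<longleftrightarrow> countable T \<and> (\<forall>n. X n \<in> measurable P (count_space T)) \<and>
     (\<forall>n s. \<P>(\<omega> in P. \<forall>k\<le>n. X k \<omega> = s k) > 0 \<longrightarrow>
        \<P>(\<omega> in P. X (Suc n) \<omega> = s (Suc n) \<bar> \<forall>k\<le>n. X k \<omega> = s k)
          = \<P>(\<omega> in P. X (Suc n) \<omega> = s (Suc n) \<bar> X n \<omega> = s n))"

text \<open>
  Forms on a subspace \<open>U\<close> are functions on \<open>U \<times> U\<close>, made extensional so that distinct members of
  the set are distinct forms.
\<close>

definition alternating_forms ::
  "(nat \<Rightarrow> 'a :: field) set \<Rightarrow> ((nat \<Rightarrow> 'a) \<times> (nat \<Rightarrow> 'a) \<Rightarrow> 'a) set" where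
  "alternating_forms U = {B \<in> extensional (U \<times> U).
     (\<forall>x\<in>U. \<forall>y\<in>U. \<forall>z\<in>U. B (x + y, z) = B (x, z) + B (y, z) \<and> B (z, x + y) = B (z, x) + B (z, y)) \<and>
     (\<forall>c. \<forall>x\<in>U. \<forall>y\<in>U. B (smul c x, y) = c * B (x, y) \<and> B (x, smul c y) = c * B (x, y)) \<and>
     (\<forall>x\<in>U. B (x, x) = 0)}"

definition form_kernel ::
  "(nat \<Rightarrow> 'a :: field) set \<Rightarrow> ((nat \<Rightarrow> 'a) \<times> (nat \<Rightarrow> 'a) \<Rightarrow> 'a) \<Rightarrow> (nat \<Rightarrow> 'a) set" where
  "form_kernel U B = {x \<in> U. \<forall>y\<in>U. B (x, y) = 0}"

end

theory Submission
  imports Defs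
begin

text \<open>
  For \<open>Z, W\<close> in \<open>OGr\<close> consider the linear relation
  \<open>E\<^sub>j = {(w mod \<ell>, t mod \<ell>). w \<in> W, z \<in> Z, w - z = \<ell>\<^sup>j t}\<close> on \<open>V \<otimes> \<bbbF>\<^sub>\<ell>\<close>, called the contact relation
  below.  Its domain is \<open>S\<^sub>j\<close> and \<open>{x. (x, 0) \<in> E\<^sub>j} = S\<^sub>j\<^sub>+\<^sub>1\<close>, and since dually
  \<open>{t. (0, t) \<in> E\<^sub>j\<^sub>+\<^sub>1}\<close> is the range of \<open>E\<^sub>j\<close>, all \<open>E\<^sub>j\<close> have the same cardinality \<open>\<ell>\<^sup>2\<^sup>m\<close>.  Isotropy of \<open>Z\<close> and \<open>W\<close>
  shows that \<open>(x, y) \<mapsto> \<langle>t, y\<rangle>\<close> for \<open>(x, t) \<in> E\<^sub>j\<close> is a well-defined alternating form on \<open>S\<^sub>j\<close> (for \<open>j \<ge> 1\<close>), and the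
  cardinality of \<open>E\<^sub>j\<close> shows that its kernel is exactly \<open>S\<^sub>j\<^sub>+\<^sub>1\<close>.

  Replacing \<open>W\<close> by \<open>g W\<close> for an isometry \<open>g = 1 + \<ell>\<^sup>j N\<close> of \<open>V\<close> does not change \<open>W\<close> modulo \<open>\<ell>\<^sup>j\<close> and adds
  the alternating form \<open>\<langle>N x, y\<rangle>\<close> to this form.  Unipotent and diagonal isometries in coordinates
  realise every alternating form on \<open>S\<^sub>j\<close> in this way, so given the reductions of \<open>Z\<close> and \<open>W\<close> modulo \<open>\<ell>\<^sup>j\<close> the
  form is uniformly distributed.
\<close>

section \<open>Arithmetic of the \<open>\<ell>\<close>-adic integers\<close>

abbreviation ell :: "'p :: prime_card adic_int" where
  "ell \<equiv> of_nat CARD('p)"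

lemma adic_nth_bounds: "0 \<le> adic_nth (a :: 'p :: prime_card adic_int) n" "adic_nth a n < int CARD('p) ^ n"
  using adic_nth[of a] by auto

lemma adic_nth_Suc_mod: "adic_nth (a :: 'p :: prime_card adic_int) (Suc n) mod int CARD('p) ^ n = adic_nth a n"
  using adic_nth[of a] by auto

lemma adic_nth_Suc_mod_ell: "adic_nth (a :: 'p :: prime_card adic_int) (Suc n) mod int CARD('p) = adic_nth a 1"
proof (induction n)
  case 0
  show ?case using adic_nth_bounds[of a 1] by simp
next
  case (Suc n)
  have "adic_nth a (Suc (Suc n)) mod int CARD('p)
      = (adic_nth a (Suc (Suc n)) mod int CARD('p) ^ Suc n) mod int CARD('p)"
    by (simp add: mod_mod_cancel)
  then show ?case using Suc by (simp only: adic_nth_Suc_mod)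
qed

lemma adic_int_eqI: "(\<And>n. adic_nth a n = adic_nth b n) \<Longrightarrow> a = b"
  by (metis adic_nth_inject ext)

lemma adic_nth_of_nat: "adic_nth (of_nat k :: 'p :: prime_card adic_int) n = int k mod int CARD('p) ^ n"
  by (induction k) (simp_all add: zero_adic_int.rep_eq plus_adic_int.rep_eq one_adic_int.rep_eq mod_simps algebra_simps)

lemma adic_nth_of_int: "adic_nth (of_int k :: 'p :: prime_card adic_int) n = k mod int CARD('p) ^ n"
  by (cases k) (simp_all add: adic_nth_of_nat uminus_adic_int.rep_eq minus_adic_int.rep_eq one_adic_int.rep_eq mod_simps del: of_nat_Suc)

text \<open>Division by the prime costs one level of precision: the entry of \<open>ell * a\<close>
  at level \<open>Suc n\<close> determines the entry of \<open>a\<close> at level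
  \<open>n\<close>.\<close>

lemma ell_mult_eq_0: "ell * (a :: 'p :: prime_card adic_int) = 0 \<Longrightarrow> a = 0"
proof (rule adic_int_eqI)
  fix n assume "ell * a = 0"
  then have "adic_nth (ell * a) (Suc n) = 0" by (simp add: zero_adic_int.rep_eq)
  then have "int CARD('p) * int CARD('p) ^ n dvd int CARD('p) * adic_nth a (Suc n)"
    by (simp add: times_adic_int.rep_eq adic_nth_of_nat mod_simps dvd_eq_mod_eq_0)
  then have "int CARD('p) ^ n dvd adic_nth a (Suc n)" by simp
  then show "adic_nth a n = adic_nth 0 n"
    by (simp add: zero_adic_int.rep_eq dvd_eq_mod_eq_0 adic_nth_Suc_mod)
qed

lemma ell_power_mult_eq_0: "ell ^ j * (a :: 'p :: prime_card adic_int) = 0 \<Longrightarrow> a = 0"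
  by (induction j) (auto dest: ell_mult_eq_0 simp: mult.assoc)

lemma ell_power_cancel: "ell ^ j * (a :: 'p :: prime_card adic_int) = ell ^ j * b \<longleftrightarrow> a = b"
  using ell_power_mult_eq_0[of j "a - b"] by (auto simp: algebra_simps)

lemma of_int_mod_card: "(of_int (x mod int CARD('p :: prime_card)) :: 'p mod_ring) = of_int x"
  unfolding of_int_of_int_mod_ring by transfer simp

lemma adic_red_add [simp]: "adic_red (a + b) = adic_red a + adic_red b"
  by (simp add: adic_red_def plus_adic_int.rep_eq of_int_mod_card)

lemma adic_red_diff [simp]: "adic_red (a - b) = adic_red a - adic_red b"
  by (simp add: adic_red_def minus_adic_int.rep_eq of_int_mod_card)

lemma adic_red_minus [simp]: "adic_red (- a) = - adic_red a"
  by (simp add: adic_red_def uminus_adic_int.rep_eq of_int_mod_card)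

lemma adic_red_mult [simp]: "adic_red (a * b) = adic_red a * adic_red b"
  by (simp add: adic_red_def times_adic_int.rep_eq of_int_mod_card)

lemma adic_red_of_int [simp]: "adic_red (of_int k) = of_int k"
  by (simp add: adic_red_def adic_nth_of_int of_int_mod_card)

lemma adic_red_0 [simp]: "adic_red 0 = 0"
  using adic_red_of_int[of 0] by simp

lemma adic_red_1 [simp]: "adic_red 1 = 1"
  using adic_red_of_int[of 1] by simp

lemma adic_red_ell [simp]: "adic_red (ell :: 'p :: prime_card adic_int) = 0"
  by (simp add: adic_red_def adic_nth_of_nat)

lemma adic_red_power [simp]: "adic_red (a ^ n) = adic_red a ^ n"
  by (induction n) simp_all

lemma adic_red_sum: "adic_red (sum f A) = (\<Sum>x\<in>A. adic_red (f x))"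
  by (induction A rule: infinite_finite_induct) simp_all

text \<open>All entries of positive index have the same residue modulo the prime, so if the first
  one vanishes they can all be divided by it; the quotients, shifted by one level, are again
  coherent.\<close>

lemma adic_red_eq_0_imp:
  assumes "adic_red (a :: 'p :: prime_card adic_int) = 0"
  shows "\<exists>b. a = ell * b"
proof -
  let ?l = "int CARD('p)"
  have l: "?l > 0" using adic_pow_pos[of 1, where 'p='p] by simp
  have "to_int_mod_ring (of_int_mod_ring (adic_nth a 1) :: 'p mod_ring) = adic_nth a 1"
    using adic_nth_bounds[of a 1] by simp
  then have a1: "adic_nth a 1 = 0"
    using assms by (simp add: adic_red_def of_int_of_int_mod_ring)
  \<comment> \<open>The index \<open>Suc n\<close> compensates for the factor lost in the division,
    so that \<open>b n\<close> lies below the \<open>n\<close>-th power of the prime.\<close>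
  define b where "b n = adic_nth a (Suc n) div ?l" for n
  have lb: "?l * b n = adic_nth a (Suc n)" for n
    using adic_nth_Suc_mod_ell[of a n] a1 by (simp add: b_def dvd_eq_mod_eq_0)
  have "0 \<le> b n \<and> b n < ?l ^ n \<and> b (Suc n) mod ?l ^ n = b n" for n
  proof (intro conjI)
    show "0 \<le> b n" using adic_nth_bounds[of a "Suc n"] l by (simp add: b_def pos_imp_zdiv_nonneg_iff)
    have "?l * b n < ?l * ?l ^ n" using adic_nth_bounds[of a "Suc n"] by (simp add: lb)
    then show "b n < ?l ^ n" using l by (simp add: mult_less_cancel_left)
    have "?l * (b (Suc n) mod ?l ^ n) = (?l * b (Suc n)) mod (?l ^ Suc n)"
      by (simp only: power_Suc mult_mod_right)
    also have "\<dots> = ?l * b n" by (simp only: lb adic_nth_Suc_mod)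
    finally show "b (Suc n) mod ?l ^ n = b n" using l by simp
  qed
  then have nth: "adic_nth (Abs_adic_int b :: 'p adic_int) = b"
    by (simp add: Abs_adic_int_inverse)
  have "a = ell * Abs_adic_int b"
  proof (rule adic_int_eqI)
    fix n
    show "adic_nth a n = adic_nth (ell * Abs_adic_int b :: 'p adic_int) n"
      by (simp add: times_adic_int.rep_eq adic_nth_of_nat mod_simps nth lb adic_nth_Suc_mod)
  qed
  then show ?thesis by blast
qed

text \<open>The inverse is the geometric series, of which only the first \<open>n\<close> terms matter modulo \<open>\<ell>\<^sup>n\<close>.\<close>

lemma one_plus_ell_multiple_invertible:
  assumes "int CARD('p) dvd x"
  shows "\<exists>u :: 'p :: prime_card adic_int. (1 + of_int x) * u = 1"
proof -
  let ?l = "int CARD('p)"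
  have dvd: "?l ^ n dvd (- x) ^ n" for n
    using assms by (intro dvd_power_same) simp
  define b where "b n = (\<Sum>k<n. (- x) ^ k) mod ?l ^ n" for n
  have "b (Suc n) mod ?l ^ n = b n" for n
  proof -
    have "b (Suc n) mod ?l ^ n = (\<Sum>k<Suc n. (- x) ^ k) mod ?l ^ n"
      unfolding b_def by (rule adic_mod_pow_Suc)
    also have "\<dots> = ((\<Sum>k<n. (- x) ^ k) + (- x) ^ n mod ?l ^ n) mod ?l ^ n"
      by (simp add: mod_simps)
    also have "\<dots> = b n" using dvd[of n] by (simp add: b_def)
    finally show ?thesis .
  qed
  then have nth: "adic_nth (Abs_adic_int b :: 'p adic_int) = b"
    by (simp add: Abs_adic_int_inverse b_def adic_pow_pos)
  have "(1 + of_int x) * Abs_adic_int b = (1 :: 'p adic_int)"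
  proof (rule adic_int_eqI)
    fix n
    have "(1 + x) * (\<Sum>k<n. (- x) ^ k) = 1 - (- x) ^ n"
      using one_diff_power_eq[of "- x" n] by simp
    then have "((1 + x) * b n) mod ?l ^ n = (1 - (- x) ^ n mod ?l ^ n) mod ?l ^ n"
      by (simp add: b_def mod_simps)
    also have "\<dots> = 1 mod ?l ^ n" using dvd[of n] by simp
    finally show "adic_nth ((1 + of_int x) * Abs_adic_int b :: 'p adic_int) n = adic_nth (1 :: 'p adic_int) n"
      by (simp add: times_adic_int.rep_eq plus_adic_int.rep_eq one_adic_int.rep_eq adic_nth_of_int nth mod_simps)
  qed
  then show ?thesis by blast
qed

section \<open>Vectors, the polar form and isotropic summands\<close>

text \<open>Every nonempty fibre is a translate of the kernel. Only closure under differences is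
  assumed, so the lemma applies to sets of vectors and to linear relations, viewed as sets of pairs,
  alike.\<close>

lemma card_additive_image:
  fixes f :: "'a :: ab_group_add \<Rightarrow> 'b :: ab_group_add"
  assumes fin: "finite G" and diff: "\<And>x y. x \<in> G \<Longrightarrow> y \<in> G \<Longrightarrow> x - y \<in> G"
    and hom: "\<And>x y. x \<in> G \<Longrightarrow> y \<in> G \<Longrightarrow> f (x - y) = f x - f y"
  shows "card G = card (f ` G) * card {x \<in> G. f x = 0}"
proof -
  have "card {x \<in> G. f x = c} = card {x \<in> G. f x = 0}" if "c \<in> f ` G" for c
  proof -
    from that obtain a where a: "a \<in> G" "f a = c" by auto
    have 0: "0 \<in> G" using diff[OF a(1) a(1)] by simp
    have minus: "- x \<in> G" if "x \<in> G" for x using diff[OF 0 that] by simp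
    have "bij_betw (\<lambda>x. x - a) {x \<in> G. f x = c} {x \<in> G. f x = 0}"
    proof (rule bij_betw_byWitness[where f' = "\<lambda>x. x + a"])
      have "x + a \<in> G \<and> f (x + a) = c" if "x \<in> G" "f x = 0" for x
      proof -
        have "x + a \<in> G" using diff[OF that(1) minus[OF a(1)]] by simp
        then show ?thesis using hom[of "x + a" a] a that by simp
      qed
      then show "(\<lambda>x. x + a) ` {x \<in> G. f x = 0} \<subseteq> {x \<in> G. f x = c}" by auto
    qed (use a diff hom in auto)
    then show ?thesis by (rule bij_betw_same_card)
  qed
  then have "(\<Sum>c\<in>f ` G. card {x \<in> G. f x = c}) = card (f ` G) * card {x \<in> G. f x = 0}" by simp
  then show ?thesis using sum.image_gen[OF fin, of "\<lambda>_. 1 :: nat" f] by simp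
qed

section \<open>Coordinatewise reduction and the bilinear form attached to Q\<close>

definition red_vec :: "(nat \<Rightarrow> 'p :: prime_card adic_int) \<Rightarrow> nat \<Rightarrow> 'p mod_ring" where
  "red_vec v = (\<lambda>i. adic_red (v i))"

text \<open>The polarisation of \<open>quad_form\<close>, see \<open>quad_form_add\<close>. It is
  defined over any commutative ring because it is used both over the \<open>ell\<close>-adic
  integers and over the residue field.\<close>

definition polar :: "nat \<Rightarrow> (nat \<Rightarrow> 'a :: comm_ring_1) \<Rightarrow> (nat \<Rightarrow> 'a) \<Rightarrow> 'a" where
  "polar m x y = (\<Sum>i<m. x i * y (m + i) + x (m + i) * y i)"

lemma red_vec_simps [simp]:
  "red_vec (x + y) = red_vec x + red_vec y"
  "red_vec (x - y) = red_vec x - red_vec y"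
  "red_vec (- x) = - red_vec x"
  "red_vec 0 = 0"
  "red_vec (smul c x) = smul (adic_red c) (red_vec x)"
  by (simp_all add: red_vec_def smul_def fun_eq_iff)

lemma smul_simps [simp]:
  fixes x y :: "nat \<Rightarrow> 'a :: comm_ring_1"
  shows "smul 0 x = 0" "smul c 0 = (0 :: nat \<Rightarrow> 'a)" "smul 1 x = x"
  by (simp_all add: smul_def fun_eq_iff)

lemma red_vec_sum: "red_vec (sum f A) = (\<Sum>x\<in>A. red_vec (f x))"
  by (induction A rule: infinite_finite_induct) (simp_all only: sum.infinite sum.empty sum.insert red_vec_simps not_False_eq_True)

lemma polar_commute: "polar m x y = polar m y x"
  by (simp add: polar_def algebra_simps)

lemma polar_add_left: "polar m (x + y) z = polar m x z + polar m y z"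
  by (simp add: polar_def algebra_simps sum.distrib)

lemma polar_diff_left: "polar m (x - y) z = polar m x z - polar m y z"
  by (simp add: polar_def algebra_simps sum.distrib sum_subtractf)

lemma polar_smul_left: "polar m (smul c x) z = c * polar m x z"
  by (simp add: polar_def smul_def algebra_simps sum_distrib_left)

lemma polar_add_right: "polar m z (x + y) = polar m z x + polar m z y"
  by (simp add: polar_commute[of m z] polar_add_left)

lemma polar_diff_right: "polar m z (x - y) = polar m z x - polar m z y"
  by (simp add: polar_commute[of m z] polar_diff_left)

lemma polar_smul_right: "polar m z (smul c x) = c * polar m z x"
  by (simp add: polar_commute[of m z] polar_smul_left)

lemmas polar_linear = polar_add_left polar_diff_left polar_smul_left
  polar_add_right polar_diff_right polar_smul_right

lemma polar_0 [simp]: "polar m 0 x = 0" "polar m x 0 = 0"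
  by (simp_all add: polar_def)

lemma adic_red_polar: "adic_red (polar m x y) = polar m (red_vec x) (red_vec y)"
  by (simp add: polar_def adic_red_sum red_vec_def)

lemma quad_form_add: "quad_form m (x + y) = quad_form m x + quad_form m y + polar m x y"
  by (simp add: quad_form_def polar_def algebra_simps sum.distrib)

lemma quad_form_smul: "quad_form m (smul c x) = c * c * quad_form m x"
  by (simp add: quad_form_def smul_def algebra_simps sum_distrib_left)

lemma quad_form_diff: "quad_form m (x - y) = quad_form m x + quad_form m y - polar m x y"
proof -
  have "x - y = x + smul (- 1) y" by (simp add: smul_def fun_eq_iff)
  then have "quad_form m (x - y) = quad_form m (x + smul (- 1) y)" by (rule arg_cong)
  also have "\<dots> = quad_form m x + quad_form m y - polar m x y"
    unfolding quad_form_add quad_form_smul polar_smul_right by simp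
  finally show ?thesis .
qed

lemma subspace_coord_space: "fmod.subspace (coord_space n)"
  by (auto simp: fmod.subspace_def coord_space_def smul_def)

lemma coord_space_closed:
  fixes x y :: "nat \<Rightarrow> 'a :: comm_ring_1"
  shows "0 \<in> (coord_space n :: (nat \<Rightarrow> 'a) set)"
  "x \<in> coord_space n \<Longrightarrow> y \<in> coord_space n \<Longrightarrow> x + y \<in> coord_space n"
  "x \<in> coord_space n \<Longrightarrow> y \<in> coord_space n \<Longrightarrow> x - y \<in> coord_space n"
  "x \<in> coord_space n \<Longrightarrow> smul c x \<in> coord_space n"
  by (auto simp: coord_space_def smul_def)

lemma red_vec_coord_space: "x \<in> coord_space n \<Longrightarrow> red_vec x \<in> coord_space n"
  by (simp add: coord_space_def red_vec_def)

lemma red_vec_eq_0_imp: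
  assumes "red_vec x = 0" "x \<in> coord_space n"
  shows "\<exists>u\<in>coord_space n. x = smul ell u"
proof -
  have "\<forall>i. \<exists>b. x i = ell * b"
    using assms(1) by (auto simp: red_vec_def fun_eq_iff intro: adic_red_eq_0_imp)
  then obtain b where b: "\<And>i. x i = ell * b i" by metis
  \<comment> \<open>The quotients \<open>b i\<close> come from a choice; cutting them off at
    \<open>n\<close> puts the witness into \<open>coord_space n\<close>.\<close>
  have "x = smul ell (\<lambda>i. if i < n then b i else 0)"
    using assms(2) b by (auto simp: smul_def coord_space_def fun_eq_iff)
  then show ?thesis by (intro bexI[where x = "\<lambda>i. if i < n then b i else 0"]) (simp_all add: coord_space_def)
qed

lemma smul_ell_power_cancel: "smul (ell ^ j) x = smul (ell ^ j) y \<longleftrightarrow> x = y"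
  by (auto simp: smul_def fun_eq_iff ell_power_cancel)

lemma card_coord_space: "card (coord_space n :: (nat \<Rightarrow> 'a :: {finite, zero}) set) = CARD('a) ^ n"
proof -
  have "bij_betw (\<lambda>v. restrict v {..<n}) (coord_space n :: (nat \<Rightarrow> 'a) set) ({..<n} \<rightarrow>\<^sub>E UNIV)"
    by (rule bij_betw_byWitness[where f' = "\<lambda>f i. if i < n then f i else 0"])
      (auto simp: coord_space_def fun_eq_iff PiE_def extensional_def restrict_def)
  then show ?thesis by (simp add: bij_betw_same_card card_PiE)
qed

lemma finite_coord_space: "finite (coord_space n :: (nat \<Rightarrow> 'a :: {finite, zero}) set)"
proof (rule card_ge_0_finite)
  have "CARD('a) > 0" by (simp add: card_gt_0_iff)
  then show "card (coord_space n :: (nat \<Rightarrow> 'a) set) > 0" by (simp add: card_coord_space)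
qed

section \<open>Members of the orthogonal Grassmannian and their reductions\<close>

lemma OGr_subset: "Z \<in> OGr m \<Longrightarrow> Z \<subseteq> V_adic m"
  by (simp add: OGr_def direct_summand_def)

lemma OGr_subspace: "Z \<in> OGr m \<Longrightarrow> fmod.subspace Z"
  by (simp add: OGr_def direct_summand_def)

lemma OGr_quad_form: "Z \<in> OGr m \<Longrightarrow> z \<in> Z \<Longrightarrow> quad_form m z = 0"
  by (simp add: OGr_def)

lemma OGr_polar: "Z \<in> OGr m \<Longrightarrow> x \<in> Z \<Longrightarrow> y \<in> Z \<Longrightarrow> polar m x y = 0"
  using quad_form_add[of m x y] fmod.subspace_add[OF OGr_subspace, of Z m x y]
  by (simp add: OGr_quad_form)

text \<open>Split \<open>u\<close> along a complement of \<open>Z\<close>: \<open>ell\<close> times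
  the complementary component lies in \<open>Z\<close> and in the complement, hence is 0, and
  \<open>ell\<close> can be cancelled.\<close>

lemma OGr_saturated:
  assumes Z: "Z \<in> OGr m" and u: "u \<in> V_adic m" "smul ell u \<in> Z"
  shows "u \<in> Z"
proof -
  obtain N where N: "fmod.subspace N" "N \<subseteq> V_adic m" "Z \<inter> N = {0}" "Z + N = V_adic m"
    using Z by (auto simp: OGr_def direct_summand_def)
  then obtain a b where ab: "a \<in> Z" "b \<in> N" "u = a + b"
    using u(1) by (metis set_plus_elim)
  have "smul ell b = smul ell u - smul ell a"
    by (simp add: ab(3) fmod.scale_right_distrib)
  then have "smul ell b \<in> Z"
    using fmod.subspace_diff[OF OGr_subspace[OF Z] u(2)] fmod.subspace_scale[OF OGr_subspace[OF Z] ab(1)]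
    by simp
  then have "smul ell b = 0"
    using N(3) fmod.subspace_scale[OF N(1) ab(2)] by blast
  then have "b = 0" using smul_ell_power_cancel[of 1 b 0] by simp
  then show ?thesis using ab by simp
qed

text \<open>A basis of \<open>Z\<close> stays a basis after reduction. The map \<open>f\<close>
  sends coefficients in the residue field to the reduced combination; it is onto by lifting
  coefficients, and injective by saturation of \<open>Z\<close> together with independence of
  \<open>B\<close>.\<close>

lemma card_red_OGr:
  fixes Z :: "(nat \<Rightarrow> 'p :: prime_card adic_int) set"
  assumes Z: "Z \<in> OGr m"
  shows "card (red_vec ` Z) = CARD('p) ^ m"
proof -
  obtain B where B: "finite B" "card B = m" "\<not> fmod.dependent B" "fmod.span B = Z"
    using Z by (auto simp: OGr_def free_of_rank_def)
  have span: "Z = range (\<lambda>u. \<Sum>b\<in>B. smul (u b) b)"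
    using fmod.span_finite[OF B(1)] B(4) by simp
  define f where "f c = (\<Sum>b\<in>B. smul (c b) (red_vec b))" for c :: "(nat \<Rightarrow> 'p adic_int) \<Rightarrow> 'p mod_ring"
  have red_sum: "red_vec (\<Sum>b\<in>B. smul (u b) b) = f (\<lambda>b. adic_red (u b))" for u
    by (simp only: f_def red_vec_sum red_vec_simps)
  have f_cong: "f c = f (restrict c B)" for c by (simp add: f_def)
  have "f ` (B \<rightarrow>\<^sub>E UNIV) = red_vec ` Z"
  proof
    show "f ` (B \<rightarrow>\<^sub>E UNIV) \<subseteq> red_vec ` Z"
    proof
      fix y assume "y \<in> f ` (B \<rightarrow>\<^sub>E UNIV)"
      then obtain c where "y = f c" by auto
      moreover define u where "u b = (of_int (to_int_mod_ring (c b)) :: 'p adic_int)" for b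
      ultimately have "y = red_vec (\<Sum>b\<in>B. smul (u b) b)"
        unfolding red_sum by (simp add: of_int_of_int_mod_ring)
      moreover have "(\<Sum>b\<in>B. smul (u b) b) \<in> Z" unfolding span by (rule rangeI)
      ultimately show "y \<in> red_vec ` Z" by simp
    qed
    show "red_vec ` Z \<subseteq> f ` (B \<rightarrow>\<^sub>E UNIV)"
    proof
      fix y assume "y \<in> red_vec ` Z"
      then obtain u where "y = red_vec (\<Sum>b\<in>B. smul (u b) b)" unfolding span by (elim imageE) simp
      then have "y = f (\<lambda>b. adic_red (u b))" by (simp only: red_sum)
      then have "y = f (restrict (\<lambda>b. adic_red (u b)) B)" using f_cong by metis
      then show "y \<in> f ` (B \<rightarrow>\<^sub>E UNIV)" by auto
    qed
  qed
  moreover have "inj_on f (B \<rightarrow>\<^sub>E UNIV)"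
  proof (rule inj_onI)
    fix c d assume c: "c \<in> B \<rightarrow>\<^sub>E UNIV" and d: "d \<in> B \<rightarrow>\<^sub>E UNIV" and eq: "f c = f d"
    define u where "u b = (of_int (to_int_mod_ring (c b)) - of_int (to_int_mod_ring (d b)) :: 'p adic_int)" for b
    have "f (\<lambda>b. adic_red (u b)) = f c - f d"
      by (simp add: u_def of_int_of_int_mod_ring f_def sum_subtractf fmod.scale_left_diff_distrib)
    then have "red_vec (\<Sum>b\<in>B. smul (u b) b) = 0" by (simp add: red_sum eq)
    moreover have uZ: "(\<Sum>b\<in>B. smul (u b) b) \<in> Z" unfolding span by (rule rangeI)
    ultimately obtain t where t: "t \<in> V_adic m" "(\<Sum>b\<in>B. smul (u b) b) = smul ell t"
      using red_vec_eq_0_imp OGr_subset[OF Z] by blast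
    \<comment> \<open>Saturation lets \<open>t\<close> be expanded in the same basis, so
      independence makes each \<open>u b\<close> a multiple of \<open>ell\<close>.\<close>
    then have "t \<in> Z" using OGr_saturated[OF Z, of t] uZ by simp
    then obtain v where v: "t = (\<Sum>b\<in>B. smul (v b) b)" unfolding span by (rule rangeE)
    define r where "r b = u b - ell * v b" for b
    have "(\<Sum>b\<in>B. smul (r b) b) = 0"
      using t(2) by (simp add: r_def v fmod.scale_left_diff_distrib sum_subtractf fmod.scale_sum_right)
    then have "\<forall>b\<in>B. r b = 0"
      using B(3) fmod.dependent_finite[OF B(1)] by blast
    then have "\<forall>b\<in>B. adic_red (u b) = 0" by (auto simp: r_def)
    then have "\<forall>b\<in>B. c b = d b" by (simp add: u_def of_int_of_int_mod_ring)
    then show "c = d" using c d by (auto intro: PiE_ext)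
  qed
  ultimately have "card (red_vec ` Z) = card (B \<rightarrow>\<^sub>E (UNIV :: 'p mod_ring set))"
    by (metis card_image)
  then show ?thesis using B by (simp add: card_PiE)
qed

section \<open>Orthogonal complements and the contact relation\<close>

definition unit_vec :: "nat \<Rightarrow> nat \<Rightarrow> 'a :: zero_neq_one" where
  "unit_vec k = (\<lambda>i. if i = k then 1 else 0)"

text \<open>The index of the coordinate with which coordinate \<open>i\<close> is paired by
  \<open>polar\<close>.\<close>

definition opp :: "nat \<Rightarrow> nat \<Rightarrow> nat" where
  "opp m i = (if i < m then m + i else i - m)"

lemma opp_less: "i < 2 * m \<Longrightarrow> opp m i < 2 * m"
  by (auto simp: opp_def)

lemma opp_opp: "i < 2 * m \<Longrightarrow> opp m (opp m i) = i"
  by (auto simp: opp_def)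

lemma opp_neq: "i < 2 * m \<Longrightarrow> opp m i \<noteq> i"
  by (auto simp: opp_def)

lemma unit_vec_coord_space: "k < n \<Longrightarrow> unit_vec k \<in> coord_space n"
  by (simp add: unit_vec_def coord_space_def)

lemma polar_unit_vec:
  assumes "k < 2 * m"
  shows "polar m x (unit_vec k) = x (opp m k)"
proof (cases "k < m")
  case True
  have "polar m x (unit_vec k) = (\<Sum>i<m. if i = k then x (m + i) else 0)"
    unfolding polar_def using True by (intro sum.cong) (auto simp: unit_vec_def)
  then show ?thesis using True by (simp add: opp_def)
next
  case False
  have "polar m x (unit_vec k) = (\<Sum>i<m. if i = k - m then x i else 0)"
    unfolding polar_def using False assms by (intro sum.cong) (auto simp: unit_vec_def)
  then show ?thesis using False assms by (simp add: opp_def)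
qed

text \<open>Pairing with the unit vector of the opposite index reads off a single
  coordinate.\<close>

lemma polar_nondegenerate:
  assumes x: "x \<in> coord_space (2 * m)" and "\<forall>y\<in>coord_space (2 * m). polar m x y = 0"
  shows "x = 0"
proof
  fix i
  show "x i = 0 i"
  proof (cases "i < 2 * m")
    case True
    then have "polar m x (unit_vec (opp m i)) = 0"
      using assms(2) by (simp add: unit_vec_coord_space opp_less)
    then show ?thesis using True by (simp add: polar_unit_vec opp_less opp_opp)
  next
    case False
    then show ?thesis using x by (simp add: coord_space_def)
  qed
qed

text \<open>A functional with one nonzero value takes all values of the field, by scaling, so its
  kernel has index \<open>CARD('a)\<close>.\<close>

lemma card_kernel_functional:
  fixes f :: "(nat \<Rightarrow> 'a :: {finite, field}) \<Rightarrow> 'a"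
  assumes G: "finite G" "fmod.subspace G"
    and diff: "\<And>x y. x \<in> G \<Longrightarrow> y \<in> G \<Longrightarrow> f (x - y) = f x - f y"
    and scale: "\<And>c x. x \<in> G \<Longrightarrow> f (smul c x) = c * f x"
    and x: "x \<in> G" "f x \<noteq> 0"
  shows "card G = CARD('a) * card {x \<in> G. f x = 0}"
proof -
  have "c \<in> f ` G" for c
  proof
    show "c = f (smul (c / f x) x)" using x by (simp add: scale)
    show "smul (c / f x) x \<in> G" using x G by (simp add: fmod.subspace_scale)
  qed
  then have "f ` G = UNIV" by blast
  then show ?thesis
    using card_additive_image[of G f] G diff by (simp add: fmod.subspace_diff)
qed

definition perp :: "nat \<Rightarrow> (nat \<Rightarrow> 'a :: comm_ring_1) set \<Rightarrow> (nat \<Rightarrow> 'a) set" where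
  "perp m U = {v \<in> coord_space (2 * m). \<forall>u\<in>U. polar m u v = 0}"

lemma card_filter_sum: "finite A \<Longrightarrow> card {x \<in> A. P x} = (\<Sum>x\<in>A. if P x then 1 else 0)"
  by (simp add: sum.If_cases Int_def)

text \<open>Both sides come from counting the pairs \<open>(u, v) \<in> U \<times> V\<close> with \<open>polar m u v = 0\<close> in two ways.\<close>

lemma card_perp:
  fixes U :: "(nat \<Rightarrow> 'a :: {finite, field}) set"
  assumes U: "fmod.subspace U" "U \<subseteq> coord_space (2 * m)"
  shows "card U * card (perp m U) = card (coord_space (2 * m) :: (nat \<Rightarrow> 'a) set)"
proof -
  let ?V = "coord_space (2 * m) :: (nat \<Rightarrow> 'a) set"
  \<comment> \<open>A field has at least two elements; writing its size as
    \<open>Suc (Suc q)\<close> makes size minus one available without subtraction on natural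
    numbers.\<close>
  obtain q where q: "CARD('a) = Suc (Suc q)"
  proof -
    have "card {0, 1 :: 'a} \<le> CARD('a)" by (rule card_mono) auto
    then show ?thesis using that[of "CARD('a) - 2"] by simp
  qed
  have finV: "finite ?V" by (rule finite_coord_space)
  have finU: "finite U" using finV U(2) by (rule rev_finite_subset)
  \<comment> \<open>Multiplying by the field size clears the denominator in the kernel size of a
    nonzero functional; the extra term is the excess of the zero functional. After summation the
    terms \<open>card U * card ?V\<close> cancel between \<open>row\<close> and
    \<open>col\<close>.\<close>
  have row: "Suc (Suc q) * card {v \<in> ?V. polar m u v = 0}
      = card ?V + (if u = 0 then Suc q * card ?V else 0)" if u: "u \<in> U" for u
  proof (cases "u = 0")
    case False
    then obtain y where "y \<in> ?V" "polar m u y \<noteq> 0"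
      using polar_nondegenerate[of u m] U(2) u by blast
    then show ?thesis
      using False card_kernel_functional[OF finV subspace_coord_space, of "polar m u" y]
      by (simp add: polar_linear q)
  qed simp
  have col: "Suc (Suc q) * card {u \<in> U. polar m u v = 0}
      = card U + (if v \<in> perp m U then Suc q * card U else 0)" if v: "v \<in> ?V" for v
  proof (cases "v \<in> perp m U")
    case False
    then obtain y where "y \<in> U" "polar m y v \<noteq> 0"
      using v by (auto simp: perp_def)
    then show ?thesis
      using False card_kernel_functional[OF finU U(1), of "\<lambda>u. polar m u v" y]
      by (simp add: polar_linear q)
  next
    case True
    then have "{u \<in> U. polar m u v = 0} = U" by (auto simp: perp_def)
    then show ?thesis using True by simp
  qed
  have "(\<Sum>u\<in>U. card {v \<in> ?V. polar m u v = 0}) = (\<Sum>v\<in>?V. card {u \<in> U. polar m u v = 0})"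
    unfolding card_filter_sum[OF finV] card_filter_sum[OF finU] by (rule sum.swap)
  then have "(\<Sum>u\<in>U. Suc (Suc q) * card {v \<in> ?V. polar m u v = 0})
      = (\<Sum>v\<in>?V. Suc (Suc q) * card {u \<in> U. polar m u v = 0})"
    by (simp only: sum_distrib_left[symmetric])
  then have "(\<Sum>u\<in>U. card ?V + (if u = 0 then Suc q * card ?V else 0))
      = (\<Sum>v\<in>?V. card U + (if v \<in> perp m U then Suc q * card U else 0))"
    by (simp only: row col cong: sum.cong)
  moreover have "(\<Sum>u\<in>U. if u = 0 then Suc q * card ?V else 0) = Suc q * card ?V"
    using finU fmod.subspace_0[OF U(1)] by (subst sum.delta) simp_all
  moreover have "(\<Sum>v\<in>?V. if v \<in> perp m U then Suc q * card U else 0) = card (perp m U) * (Suc q * card U)"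
  proof -
    have "?V \<inter> {v. v \<in> perp m U} = perp m U" by (auto simp: perp_def)
    then show ?thesis using finV by (simp only: sum.If_cases sum_constant) simp
  qed
  ultimately have "Suc q * card ?V = Suc q * (card U * card (perp m U))"
    by (simp only: sum.distrib sum_constant) (simp add: algebra_simps)
  then show ?thesis by (simp only: Suc_mult_cancel1)
qed

section \<open>The contact relation of a pair and its cardinality\<close>

definition contact_rel :: "nat \<Rightarrow> nat \<Rightarrow> (nat \<Rightarrow> 'p :: prime_card adic_int) set \<Rightarrow> (nat \<Rightarrow> 'p adic_int) set \<Rightarrow>
    ((nat \<Rightarrow> 'p mod_ring) \<times> (nat \<Rightarrow> 'p mod_ring)) set" where
  "contact_rel m j Z W = {(red_vec w, red_vec t) | w z t.
     w \<in> W \<and> z \<in> Z \<and> t \<in> V_adic m \<and> w - z = smul (ell ^ j) t}"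

lemma contact_relI:
  "w \<in> W \<Longrightarrow> z \<in> Z \<Longrightarrow> t \<in> V_adic m \<Longrightarrow> w - z = smul (ell ^ j) t
    \<Longrightarrow> (red_vec w, red_vec t) \<in> contact_rel m j Z W"
  unfolding contact_rel_def by blast

lemma contact_relE:
  assumes "(x, y) \<in> contact_rel m j Z W"
  obtains w z t where "x = red_vec w" "y = red_vec t" "w \<in> W" "z \<in> Z" "t \<in> V_adic m"
    "w - z = smul (ell ^ j) t"
  using assms unfolding contact_rel_def by blast

lemma subspace_ell_pow_V: "fmod.subspace (ell_pow_V m j :: (nat \<Rightarrow> 'p :: prime_card adic_int) set)"
proof -
  have "module_hom smul smul (smul (ell ^ j) :: (nat \<Rightarrow> 'p adic_int) \<Rightarrow> _)"
    by unfold_locales (simp_all add: fmod.scale_right_distrib mult.commute)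
  then show ?thesis
    unfolding ell_pow_V_def by (rule module_hom.subspace_image) (rule subspace_coord_space)
qed

lemmas ell_pow_V_closed = fmod.subspace_0[OF subspace_ell_pow_V]
  fmod.subspace_add[OF subspace_ell_pow_V] fmod.subspace_diff[OF subspace_ell_pow_V]

lemma coset_eq_iff: "v +o ell_pow_V m j = w +o ell_pow_V m j \<longleftrightarrow> v - w \<in> ell_pow_V m j"
proof
  assume "v +o ell_pow_V m j = w +o ell_pow_V m j"
  then have "v + 0 \<in> w +o ell_pow_V m j"
    using set_plus_intro2[OF ell_pow_V_closed(1)] by metis
  then show "v - w \<in> ell_pow_V m j" by (auto simp: elt_set_plus_def)
next
  assume vw: "v - w \<in> ell_pow_V m j"
  show "v +o ell_pow_V m j = w +o ell_pow_V m j"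
  proof (intro equalityI subsetI)
    fix x assume "x \<in> v +o ell_pow_V m j"
    then obtain l where l: "l \<in> ell_pow_V m j" "x = v + l" by (auto simp: elt_set_plus_def)
    then have "x = w + ((v - w) + l)" by simp
    then show "x \<in> w +o ell_pow_V m j"
      using ell_pow_V_closed(2)[OF vw l(1)] unfolding elt_set_plus_def by blast
  next
    fix x assume "x \<in> w +o ell_pow_V m j"
    then obtain l where l: "l \<in> ell_pow_V m j" "x = w + l" by (auto simp: elt_set_plus_def)
    then have "x = v + (l - (v - w))" by simp
    then show "x \<in> v +o ell_pow_V m j"
      using ell_pow_V_closed(3)[OF l(1) vw] unfolding elt_set_plus_def by blast
  qed
qed

lemma red_vec_ell_pow_V: "x \<in> ell_pow_V m j \<Longrightarrow> j \<ge> 1 \<Longrightarrow> red_vec x = 0"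
  by (auto simp: ell_pow_V_def)

text \<open>Two vectors have the same coset at level \<open>j\<close> iff their difference is
  \<open>ell ^ j\<close> times a vector of \<open>V\<close>, which is the defining condition of the
  relation. For \<open>j \<ge> 1\<close> all other summands lie in \<open>ell\<close> times
  \<open>V\<close> and reduce to 0.\<close>

lemma S_seq_eq_contact_rel:
  assumes "j \<ge> 1"
  shows "S_seq m Z W j = fst ` contact_rel m j Z W"
proof (intro equalityI subsetI)
  fix x assume "x \<in> S_seq m Z W j"
  then obtain v a b where v: "x = red_vec v" "a \<in> image_mod m j W \<inter> image_mod m j Z"
      "b \<in> image_mod m j (ell_pow_V m 1)" "v \<in> a + b"
    using assms by (auto simp: S_seq_def red_vec_def elim!: set_plus_elim)
  then obtain w z u where w: "w \<in> W" "z \<in> Z" "a = w +o ell_pow_V m j" "a = z +o ell_pow_V m j"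
      "u \<in> ell_pow_V m 1" "b = u +o ell_pow_V m j"
    unfolding image_mod_def by blast
  then have "w - z \<in> ell_pow_V m j" by (metis coset_eq_iff)
  then obtain t where t: "t \<in> V_adic m" "w - z = smul (ell ^ j) t" by (auto simp: ell_pow_V_def)
  obtain l l' where "l \<in> ell_pow_V m j" "l' \<in> ell_pow_V m j" "v = (w + l) + (u + l')"
    using v(4) w(3,6) by (auto simp: elt_set_plus_def elim!: set_plus_elim)
  then have "x = red_vec w"
    using v(1) w(5) assms by (simp add: red_vec_ell_pow_V)
  then show "x \<in> fst ` contact_rel m j Z W"
    using contact_relI[OF w(1,2) t] by force
next
  fix x assume "x \<in> fst ` contact_rel m j Z W"
  then obtain w z t where w: "x = red_vec w" "w \<in> W" "z \<in> Z" "t \<in> V_adic m" "w - z = smul (ell ^ j) t"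
    by (auto elim: contact_relE)
  then have "w +o ell_pow_V m j = z +o ell_pow_V m j"
    unfolding coset_eq_iff by (auto simp: ell_pow_V_def)
  then have a: "w +o ell_pow_V m j \<in> image_mod m j W \<inter> image_mod m j Z"
    using w(2,3) unfolding image_mod_def by blast
  \<comment> \<open>For this inclusion the zero coset is summand enough from the image of
    \<open>ell_pow_V m 1\<close>.\<close>
  have b: "0 +o ell_pow_V m j \<in> image_mod m j (ell_pow_V m 1)"
    unfolding image_mod_def by (rule imageI) (rule ell_pow_V_closed)
  have "(w + 0) + (0 + 0) \<in> (w +o ell_pow_V m j) + (0 +o ell_pow_V m j)"
    by (intro set_plus_intro set_plus_intro2 ell_pow_V_closed)
  then have "w \<in> (w +o ell_pow_V m j) + (0 +o ell_pow_V m j)" by simp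
  then have "w \<in> \<Union> ((image_mod m j W \<inter> image_mod m j Z) + image_mod m j (ell_pow_V m 1))"
    using set_plus_intro[OF a b] by blast
  then show "x \<in> S_seq m Z W j"
    using assms w(1) by (auto simp: S_seq_def red_vec_def)
qed

context
  fixes m :: nat and Z W :: "(nat \<Rightarrow> 'p :: prime_card adic_int) set"
  assumes Z: "Z \<in> OGr m" and W: "W \<in> OGr m"
begin

lemma contact_rel_add:
  assumes "(x, s) \<in> contact_rel m j Z W" "(y, t) \<in> contact_rel m j Z W"
  shows "(x + y, s + t) \<in> contact_rel m j Z W"
proof -
  obtain w z u where 1: "x = red_vec w" "s = red_vec u" "w \<in> W" "z \<in> Z" "u \<in> V_adic m" "w - z = smul (ell ^ j) u"
    using assms(1) by (rule contact_relE)
  obtain w' z' u' where 2: "y = red_vec w'" "t = red_vec u'" "w' \<in> W" "z' \<in> Z" "u' \<in> V_adic m" "w' - z' = smul (ell ^ j) u'"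
    using assms(2) by (rule contact_relE)
  have "(w + w') - (z + z') = smul (ell ^ j) (u + u')"
    by (simp add: fmod.scale_right_distrib 1(6)[symmetric] 2(6)[symmetric])
  then have "(red_vec (w + w'), red_vec (u + u')) \<in> contact_rel m j Z W"
    using 1 2 by (intro contact_relI[where z = "z + z'"] fmod.subspace_add[OF OGr_subspace[OF W]]
      fmod.subspace_add[OF OGr_subspace[OF Z]] coord_space_closed)
  then show ?thesis by (simp add: 1 2)
qed

lemma contact_rel_smul:
  assumes "(x, s) \<in> contact_rel m j Z W"
  shows "(smul c x, smul c s) \<in> contact_rel m j Z W"
proof -
  obtain w z u where 1: "x = red_vec w" "s = red_vec u" "w \<in> W" "z \<in> Z" "u \<in> V_adic m" "w - z = smul (ell ^ j) u"
    using assms(1) by (rule contact_relE)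
  \<comment> \<open>An integral lift of the residue \<open>c\<close>, so that the scaling can be
    carried out on the vectors \<open>w\<close>, \<open>z\<close> and \<open>u\<close>.\<close>
  define a where "a = (of_int (to_int_mod_ring c) :: 'p adic_int)"
  have "smul a w - smul a z = smul a (w - z)" by (simp add: fmod.scale_right_diff_distrib)
  also have "\<dots> = smul (ell ^ j) (smul a u)" by (simp add: 1 mult.commute)
  finally have "(red_vec (smul a w), red_vec (smul a u)) \<in> contact_rel m j Z W"
    using 1 by (intro contact_relI[where z = "smul a z"] fmod.subspace_scale[OF OGr_subspace[OF W]]
      fmod.subspace_scale[OF OGr_subspace[OF Z]] coord_space_closed)
  then show ?thesis by (simp add: 1 a_def of_int_of_int_mod_ring)
qed

lemma contact_rel_diff:
  assumes "(x, s) \<in> contact_rel m j Z W" "(y, t) \<in> contact_rel m j Z W"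
  shows "(x - y, s - t) \<in> contact_rel m j Z W"
proof -
  have "smul (- 1) v = - v" for v :: "nat \<Rightarrow> 'p mod_ring" by (simp add: smul_def fun_eq_iff)
  then show ?thesis
    using contact_rel_add[OF assms(1) contact_rel_smul[OF assms(2), of "- 1"]] by simp
qed

lemma contact_rel_minus:
  assumes "p \<in> contact_rel m j Z W" "q \<in> contact_rel m j Z W"
  shows "p - q \<in> contact_rel m j Z W"
  using contact_rel_diff[of "fst p" "snd p" j "fst q" "snd q"] assms by (simp add: minus_prod_def)

lemma contact_rel_subset: "contact_rel m j Z W \<subseteq> V_mod m \<times> V_mod m"
  using OGr_subset[OF W] by (auto elim!: contact_relE intro: red_vec_coord_space)

lemma finite_contact_rel: "finite (contact_rel m j Z W)"
  by (rule finite_subset[OF contact_rel_subset]) (simp add: finite_coord_space)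

text \<open>A partner \<open>t\<close> that reduces to 0 is divisible by \<open>ell\<close>, and
  this factor raises the contact of \<open>w\<close> and \<open>z\<close> by one level.\<close>

lemma contact_rel_Suc_domain: "fst ` contact_rel m (Suc j) Z W = {x. (x, 0) \<in> contact_rel m j Z W}"
proof (intro equalityI subsetI)
  fix x assume "x \<in> fst ` contact_rel m (Suc j) Z W"
  then obtain w z t where w: "x = red_vec w" "w \<in> W" "z \<in> Z" "t \<in> V_adic m" "w - z = smul (ell ^ Suc j) t"
    by (auto elim: contact_relE)
  have "w - z = smul (ell ^ j) (smul ell t)" by (simp add: w(5) mult.commute)
  then have "(red_vec w, red_vec (smul ell t)) \<in> contact_rel m j Z W"
    using w by (intro contact_relI coord_space_closed)
  then show "x \<in> {x. (x, 0) \<in> contact_rel m j Z W}" by (simp add: w)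
next
  fix x assume "x \<in> {x. (x, 0) \<in> contact_rel m j Z W}"
  then have "(x, 0) \<in> contact_rel m j Z W" by simp
  then obtain w z t where w: "x = red_vec w" "0 = red_vec t" "w \<in> W" "z \<in> Z" "t \<in> V_adic m" "w - z = smul (ell ^ j) t"
    by (rule contact_relE)
  obtain u where u: "u \<in> V_adic m" "t = smul ell u" using red_vec_eq_0_imp[OF w(2)[symmetric] w(5)] by blast
  have "w - z = smul (ell ^ Suc j) u" by (simp add: w u mult.commute)
  then have "(red_vec w, red_vec u) \<in> contact_rel m (Suc j) Z W"
    using w u by (intro contact_relI)
  then show "x \<in> fst ` contact_rel m (Suc j) Z W" using w(1) by force
qed

text \<open>If \<open>w\<close> reduces to 0, so does \<open>z\<close>, because they agree modulo a
  positive power of \<open>ell\<close>. By saturation both are \<open>ell\<close> times members of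
  \<open>W\<close> and \<open>Z\<close>, and dividing by \<open>ell\<close> lowers the level without
  changing \<open>t\<close>.\<close>

lemma contact_rel_Suc_zero: "{t. (0, t) \<in> contact_rel m (Suc j) Z W} = snd ` contact_rel m j Z W"
proof (intro equalityI subsetI)
  fix y assume "y \<in> {t. (0, t) \<in> contact_rel m (Suc j) Z W}"
  then have "(0, y) \<in> contact_rel m (Suc j) Z W" by simp
  then obtain w z t where w: "0 = red_vec w" "y = red_vec t" "w \<in> W" "z \<in> Z" "t \<in> V_adic m" "w - z = smul (ell ^ Suc j) t"
    by (rule contact_relE)
  have wV: "w \<in> V_adic m" "z \<in> V_adic m" using w OGr_subset[OF W] OGr_subset[OF Z] by auto
  have "z = w - smul (ell ^ Suc j) t" using w(6) by (simp add: algebra_simps)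
  then have rz: "red_vec z = 0" using w(1) by simp
  obtain w' where w': "w' \<in> V_adic m" "w = smul ell w'" using red_vec_eq_0_imp[OF w(1)[symmetric] wV(1)] by blast
  obtain z' where z': "z' \<in> V_adic m" "z = smul ell z'" using red_vec_eq_0_imp[OF rz wV(2)] by blast
  have in': "w' \<in> W" "z' \<in> Z" using OGr_saturated[OF W w'(1)] OGr_saturated[OF Z z'(1)] w z' w' by auto
  have "smul (ell ^ 1) (w' - z') = smul (ell ^ 1) (smul (ell ^ j) t)"
    using w(6) by (simp add: w' z' fmod.scale_right_diff_distrib)
  then have "w' - z' = smul (ell ^ j) t" by (simp only: smul_ell_power_cancel)
  then have "(red_vec w', red_vec t) \<in> contact_rel m j Z W" using in' w by (intro contact_relI)
  then show "y \<in> snd ` contact_rel m j Z W" using w(2) by force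
next
  fix y assume "y \<in> snd ` contact_rel m j Z W"
  then obtain w z t where w: "y = red_vec t" "w \<in> W" "z \<in> Z" "t \<in> V_adic m" "w - z = smul (ell ^ j) t"
    by (auto elim: contact_relE)
  have "smul ell w - smul ell z = smul (ell ^ Suc j) t"
    using w by (simp add: fmod.scale_right_diff_distrib[symmetric])
  then have "(red_vec (smul ell w), red_vec t) \<in> contact_rel m (Suc j) Z W"
    using w by (intro contact_relI[where z = "smul ell z"] fmod.subspace_scale[OF OGr_subspace[OF W]]
      fmod.subspace_scale[OF OGr_subspace[OF Z]])
  then show "y \<in> {t. (0, t) \<in> contact_rel m (Suc j) Z W}" by (simp add: w)
qed

text \<open>Rank-nullity for the first projection, in multiplicative form;
  \<open>card_contact_rel_snd\<close> is the same for the second one.\<close>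

lemma card_contact_rel_fst:
  "card (contact_rel m j Z W) = card (fst ` contact_rel m j Z W) * card {t. (0, t) \<in> contact_rel m j Z W}"
proof -
  have "{p \<in> contact_rel m j Z W. fst p = 0} = Pair 0 ` {t. (0, t) \<in> contact_rel m j Z W}" by force
  moreover have "card (Pair (0 :: nat \<Rightarrow> 'p mod_ring) ` {t. (0, t) \<in> contact_rel m j Z W}) = card {t. (0, t) \<in> contact_rel m j Z W}"
    by (rule card_image) (simp add: inj_on_def)
  moreover have "card (contact_rel m j Z W)
      = card (fst ` contact_rel m j Z W) * card {p \<in> contact_rel m j Z W. fst p = 0}"
    by (rule card_additive_image[OF finite_contact_rel contact_rel_minus]) simp_all
  ultimately show ?thesis by simp
qed

lemma card_contact_rel_snd:
  "card (contact_rel m j Z W) = card (snd ` contact_rel m j Z W) * card {x. (x, 0) \<in> contact_rel m j Z W}"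
proof -
  have "{p \<in> contact_rel m j Z W. snd p = 0} = (\<lambda>x. (x, 0)) ` {x. (x, 0) \<in> contact_rel m j Z W}" by force
  moreover have "card ((\<lambda>x. (x, 0 :: nat \<Rightarrow> 'p mod_ring)) ` {x. (x, 0) \<in> contact_rel m j Z W}) = card {x. (x, 0) \<in> contact_rel m j Z W}"
    by (rule card_image) (simp add: inj_on_def)
  moreover have "card (contact_rel m j Z W)
      = card (snd ` contact_rel m j Z W) * card {p \<in> contact_rel m j Z W. snd p = 0}"
    by (rule card_additive_image[OF finite_contact_rel contact_rel_minus]) simp_all
  ultimately show ?thesis by simp
qed

text \<open>In the induction step, \<open>contact_rel_Suc_domain\<close> and
  \<open>contact_rel_Suc_zero\<close> identify image and kernel of the first projection at level
  \<open>Suc j\<close> with kernel and image of the second projection at level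
  \<open>j\<close>.\<close>

lemma card_contact_rel: "card (contact_rel m j Z W) = CARD('p) ^ (2 * m)"
proof (induction j)
  case 0
  \<comment> \<open>At level 0 there is no divisibility condition, so \<open>w\<close> and
    \<open>z\<close> vary independently.\<close>
  have "contact_rel m 0 Z W = (\<lambda>(x, y). (x, x - y)) ` (red_vec ` W \<times> red_vec ` Z)"
  proof (intro equalityI subsetI)
    fix p assume "p \<in> contact_rel m 0 Z W"
    then obtain w z t where "p = (red_vec w, red_vec t)" "w \<in> W" "z \<in> Z" "w - z = t"
      by (cases p) (auto elim: contact_relE)
    then show "p \<in> (\<lambda>(x, y). (x, x - y)) ` (red_vec ` W \<times> red_vec ` Z)" by force
  next
    fix p assume "p \<in> (\<lambda>(x, y). (x, x - y)) ` (red_vec ` W \<times> red_vec ` Z)"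
    then obtain w z where w: "p = (red_vec w, red_vec (w - z))" "w \<in> W" "z \<in> Z" by auto
    have "w - z \<in> V_adic m" using w OGr_subset[OF W] OGr_subset[OF Z] by (intro coord_space_closed) auto
    then show "p \<in> contact_rel m 0 Z W" unfolding w(1) using w by (intro contact_relI) auto
  qed
  moreover have "inj_on (\<lambda>(x, y). (x, x - y)) (red_vec ` W \<times> red_vec ` Z)" by (auto simp: inj_on_def)
  ultimately have "card (contact_rel m 0 Z W) = card (red_vec ` W \<times> red_vec ` Z)"
    by (simp only: card_image)
  then show ?case
    by (simp add: card_cartesian_product card_red_OGr[OF Z] card_red_OGr[OF W] mult_2 power_add)
next
  case (Suc j)
  have "card (contact_rel m (Suc j) Z W) = card (contact_rel m j Z W)"
    unfolding card_contact_rel_fst[of "Suc j"] contact_rel_Suc_domain contact_rel_Suc_zero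
    by (simp add: card_contact_rel_snd[of j] mult.commute)
  then show ?case using Suc by simp
qed

text \<open>Expand \<open>polar m z z' = 0\<close> with \<open>z = w - ell ^ j u\<close> and
  likewise for \<open>z'\<close>. The term \<open>polar m w w'\<close> vanishes, one factor
  \<open>ell ^ j\<close> cancels, and what still carries \<open>ell ^ j\<close> dies under reduction
  since \<open>j \<ge> 1\<close>.\<close>

lemma contact_rel_skew:
  assumes "j \<ge> 1" "(x, s) \<in> contact_rel m j Z W" "(y, t) \<in> contact_rel m j Z W"
  shows "polar m s y = - polar m x t"
proof -
  obtain w z u where 1: "x = red_vec w" "s = red_vec u" "w \<in> W" "z \<in> Z" "u \<in> V_adic m" "w - z = smul (ell ^ j) u"
    using assms(2) by (rule contact_relE)
  obtain w' z' u' where 2: "y = red_vec w'" "t = red_vec u'" "w' \<in> W" "z' \<in> Z" "u' \<in> V_adic m" "w' - z' = smul (ell ^ j) u'"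
    using assms(3) by (rule contact_relE)
  have z: "z = w - smul (ell ^ j) u" "z' = w' - smul (ell ^ j) u'"
    using 1(6) 2(6) by (simp_all add: algebra_simps)
  have "0 = polar m z z'" using OGr_polar[OF Z] 1 2 by simp
  also have "\<dots> = polar m w w' - ell ^ j * (polar m w u' + polar m u w' - ell ^ j * polar m u u')"
    unfolding z by (simp add: polar_linear algebra_simps)
  also have "polar m w w' = 0" using OGr_polar[OF W] 1 2 by simp
  finally have "ell ^ j * (polar m w u' + polar m u w' - ell ^ j * polar m u u') = 0" by simp
  then have "polar m w u' + polar m u w' - ell ^ j * polar m u u' = 0"
    by (rule ell_power_mult_eq_0)
  then have "adic_red (polar m w u' + polar m u w' - ell ^ j * polar m u u') = 0" by simp
  then have "polar m x t + polar m s y = 0"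
    using assms(1) by (simp add: adic_red_polar 1 2 power_0_left)
  then show ?thesis by (simp add: add_eq_0_iff)
qed

text \<open>The same expansion for the quadratic form itself. Skew-symmetry alone would not give
  this over the field with two elements.\<close>

lemma contact_rel_alternating:
  assumes "j \<ge> 1" "(x, s) \<in> contact_rel m j Z W"
  shows "polar m s x = 0"
proof -
  obtain w z u where 1: "x = red_vec w" "s = red_vec u" "w \<in> W" "z \<in> Z" "u \<in> V_adic m" "w - z = smul (ell ^ j) u"
    using assms(2) by (rule contact_relE)
  have z: "z = w - smul (ell ^ j) u" using 1(6) by (simp add: algebra_simps)
  have "0 = quad_form m z" using OGr_quad_form[OF Z] 1 by simp
  also have "\<dots> = quad_form m w - ell ^ j * (polar m w u - ell ^ j * quad_form m u)"
    unfolding z by (simp add: quad_form_diff quad_form_smul polar_linear algebra_simps)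
  also have "quad_form m w = 0" using OGr_quad_form[OF W] 1 by simp
  finally have "ell ^ j * (polar m w u - ell ^ j * quad_form m u) = 0" by simp
  then have "polar m w u - ell ^ j * quad_form m u = 0" by (rule ell_power_mult_eq_0)
  then have "adic_red (polar m w u - ell ^ j * quad_form m u) = 0" by simp
  then show ?thesis
    using assms(1) by (simp add: adic_red_polar 1 power_0_left polar_commute)
qed

lemma subspace_contact_rel_domain: "fmod.subspace (fst ` contact_rel m j Z W)"
proof -
  have "(0, 0) \<in> contact_rel m j Z W"
    using contact_relI[of 0 W 0 Z 0 m j] fmod.subspace_0[OF OGr_subspace[OF W]]
      fmod.subspace_0[OF OGr_subspace[OF Z]] by (simp add: coord_space_closed)
  then have 0: "0 \<in> fst ` contact_rel m j Z W" by (rule image_eqI[rotated]) simp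
  show ?thesis
    unfolding fmod.subspace_def
  proof (intro conjI ballI allI 0)
    fix x y assume "x \<in> fst ` contact_rel m j Z W" "y \<in> fst ` contact_rel m j Z W"
    then obtain s t where "(x, s) \<in> contact_rel m j Z W" "(y, t) \<in> contact_rel m j Z W" by auto
    then have "(x + y, s + t) \<in> contact_rel m j Z W" by (rule contact_rel_add)
    then show "x + y \<in> fst ` contact_rel m j Z W" by (rule image_eqI[rotated]) simp
  next
    fix c x assume "x \<in> fst ` contact_rel m j Z W"
    then obtain s where "(x, s) \<in> contact_rel m j Z W" by auto
    then have "(smul c x, smul c s) \<in> contact_rel m j Z W" by (rule contact_rel_smul)
    then show "smul c x \<in> fst ` contact_rel m j Z W" by (rule image_eqI[rotated]) simp
  qed
qed

text \<open>Skew-symmetry gives one inclusion. Equality follows by counting: the size of the domain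
  times either side is the size of the whole space, by \<open>card_contact_rel\<close> and by
  \<open>card_perp\<close>.\<close>

lemma contact_rel_zero_eq_perp:
  assumes "j \<ge> 1"
  shows "{t. (0, t) \<in> contact_rel m j Z W} = perp m (fst ` contact_rel m j Z W)" (is "?T = perp m ?U")
proof (rule card_subset_eq)
  have UV: "?U \<subseteq> V_mod m" using contact_rel_subset[of j] by auto
  show "finite (perp m ?U)" by (rule finite_subset[OF _ finite_coord_space]) (auto simp: perp_def)
  show "?T \<subseteq> perp m ?U"
  proof
    fix t assume "t \<in> ?T"
    then have t: "(0, t) \<in> contact_rel m j Z W" by simp
    have "polar m u t = 0" if "u \<in> ?U" for u
    proof -
      from that obtain s where "(u, s) \<in> contact_rel m j Z W" by auto
      then show ?thesis using contact_rel_skew[OF assms t] polar_commute[of m u t] by simp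
    qed
    then show "t \<in> perp m ?U" using t contact_rel_subset[of j] by (auto simp: perp_def)
  qed
  have eq: "card ?U * card ?T = card ?U * card (perp m ?U)"
    unfolding card_perp[OF subspace_contact_rel_domain UV] card_coord_space CARD_mod_ring
      card_contact_rel_fst[symmetric] card_contact_rel ..
  have "finite ?U" "0 \<in> ?U"
    using finite_subset[OF UV finite_coord_space] fmod.subspace_0[OF subspace_contact_rel_domain] by auto
  then have "card ?U \<noteq> 0" by auto
  then show "card ?T = card (perp m ?U)" using eq by simp
qed

end

text \<open>The value does not depend on the choice of \<open>t\<close>: see \<open>contact_form_eq\<close>.\<close>

definition contact_form :: "nat \<Rightarrow> nat \<Rightarrow> (nat \<Rightarrow> 'p :: prime_card adic_int) set \<Rightarrow> (nat \<Rightarrow> 'p adic_int) set \<Rightarrow>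
    (nat \<Rightarrow> 'p mod_ring) \<times> (nat \<Rightarrow> 'p mod_ring) \<Rightarrow> 'p mod_ring" where
  "contact_form m j Z W = (\<lambda>(x, y). polar m (SOME t. (x, t) \<in> contact_rel m j Z W) y)"

context
  fixes m j :: nat and Z W :: "(nat \<Rightarrow> 'p :: prime_card adic_int) set"
  assumes Z: "Z \<in> OGr m" and W: "W \<in> OGr m" and j: "j \<ge> 1"
begin

text \<open>Two partners of \<open>x\<close> differ by a partner of 0, which is orthogonal to the
  domain of the relation.\<close>

lemma contact_form_eq:
  assumes "(x, t) \<in> contact_rel m j Z W" "(y, s) \<in> contact_rel m j Z W"
  shows "contact_form m j Z W (x, y) = polar m t y"
proof -
  define t' where "t' = (SOME t. (x, t) \<in> contact_rel m j Z W)"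
  have "(x, t') \<in> contact_rel m j Z W" 
    using someI[of "\<lambda>t. (x, t) \<in> contact_rel m j Z W", OF assms(1)] by (simp only: t'_def)
  then have "(0, t' - t) \<in> contact_rel m j Z W"
    using contact_rel_diff[OF Z W _ assms(1), of x t'] by simp
  then have "polar m (t' - t) y = 0" using contact_rel_skew[OF Z W j _ assms(2)] by simp
  then show ?thesis by (simp add: contact_form_def t'_def polar_diff_left)
qed

text \<open>Since any partner may be used to evaluate the form, bilinearity follows from closure of
  the relation under sums and multiples.\<close>

lemma contact_form_alternating:
  defines "U \<equiv> S_seq m Z W j"
  shows "restrict (contact_form m j Z W) (U \<times> U) \<in> alternating_forms U"
proof -
  note eq = contact_form_eq
  have U: "U = fst ` contact_rel m j Z W" unfolding U_def by (rule S_seq_eq_contact_rel[OF j])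
  have lift: "\<exists>t. (x, t) \<in> contact_rel m j Z W" if "x \<in> U" for x using that by (auto simp: U)
  have sub: "fmod.subspace U" unfolding U by (rule subspace_contact_rel_domain[OF Z W])
  note clo = fmod.subspace_add[OF sub] fmod.subspace_scale[OF sub]
  let ?f = "contact_form m j Z W"
  have add: "?f (x + y, z) = ?f (x, z) + ?f (y, z) \<and> ?f (z, x + y) = ?f (z, x) + ?f (z, y)"
    if xyz: "x \<in> U" "y \<in> U" "z \<in> U" for x y z
  proof -
    obtain t s r where r: "(x, t) \<in> contact_rel m j Z W" "(y, s) \<in> contact_rel m j Z W"
        "(z, r) \<in> contact_rel m j Z W" using xyz[THEN lift] by blast
    show ?thesis
      using eq[OF r(1,3)] eq[OF r(2,3)] eq[OF contact_rel_add[OF Z W r(1,2)] r(3)]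
        eq[OF r(3,1)] eq[OF r(3,2)] eq[OF r(3) contact_rel_add[OF Z W r(1,2)]]
      by (simp add: polar_linear)
  qed
  have scale: "?f (smul c x, y) = c * ?f (x, y) \<and> ?f (x, smul c y) = c * ?f (x, y)"
    if xy: "x \<in> U" "y \<in> U" for c x y
  proof -
    obtain t s where r: "(x, t) \<in> contact_rel m j Z W" "(y, s) \<in> contact_rel m j Z W"
      using xy[THEN lift] by blast
    show ?thesis
      using eq[OF r] eq[OF contact_rel_smul[OF Z W r(1)] r(2)] eq[OF r(1) contact_rel_smul[OF Z W r(2)]]
      by (simp add: polar_linear)
  qed
  have alt: "?f (x, x) = 0" if "x \<in> U" for x
    using lift[OF that] eq contact_rel_alternating[OF Z W j] by auto
  show ?thesis
    unfolding alternating_forms_def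
  proof (intro CollectI conjI ballI allI)
    fix x y z assume "x \<in> U" "y \<in> U" "z \<in> U"
    then show "restrict ?f (U \<times> U) (x + y, z) = restrict ?f (U \<times> U) (x, z) + restrict ?f (U \<times> U) (y, z)"
      "restrict ?f (U \<times> U) (z, x + y) = restrict ?f (U \<times> U) (z, x) + restrict ?f (U \<times> U) (z, y)"
      using add[of x y z] clo(1)[of x y] by simp_all
  next
    fix c x y assume "x \<in> U" "y \<in> U"
    then show "restrict ?f (U \<times> U) (smul c x, y) = c * restrict ?f (U \<times> U) (x, y)"
      "restrict ?f (U \<times> U) (x, smul c y) = c * restrict ?f (U \<times> U) (x, y)"
      using scale[of x y c] clo(2)[of x c] clo(2)[of y c] by simp_all
  qed (simp_all add: alt)
qed

text \<open>A vector \<open>x\<close> with \<open>(x, t)\<close> in the relation is in the kernel iff \<open>t\<close> is orthogonal to the domain,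
  i.e. iff \<open>(0, t)\<close> is in the relation, i.e. iff \<open>(x, 0)\<close> is.\<close>

lemma form_kernel_contact_form:
  defines "U \<equiv> S_seq m Z W j"
  shows "form_kernel U (restrict (contact_form m j Z W) (U \<times> U)) = S_seq m Z W (Suc j)"
proof -
  have U: "U = fst ` contact_rel m j Z W" unfolding U_def by (rule S_seq_eq_contact_rel[OF j])
  have S: "S_seq m Z W (Suc j) = {x. (x, 0) \<in> contact_rel m j Z W}"
    using S_seq_eq_contact_rel[of "Suc j" m Z W] contact_rel_Suc_domain[OF Z W] by simp
  show ?thesis
  proof (intro equalityI subsetI)
    fix x assume x: "x \<in> form_kernel U (restrict (contact_form m j Z W) (U \<times> U))"
    then have "x \<in> U" by (simp add: form_kernel_def)
    then obtain t where t: "(x, t) \<in> contact_rel m j Z W" by (auto simp: U)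
    have "polar m y t = 0" if y: "y \<in> U" for y
    proof -
      obtain s where "(y, s) \<in> contact_rel m j Z W" using y by (auto simp: U)
      then have "polar m t y = contact_form m j Z W (x, y)" using contact_form_eq[OF t] by simp
      also have "\<dots> = 0" using x y by (auto simp: form_kernel_def)
      finally show ?thesis by (simp add: polar_commute)
    qed
    moreover have "t \<in> V_mod m" using contact_rel_subset[OF Z W, of j] t by auto
    ultimately have "t \<in> perp m U" by (simp add: perp_def)
    then have "(0, t) \<in> contact_rel m j Z W"
      using contact_rel_zero_eq_perp[OF Z W j] by (auto simp: U)
    then have "(x - 0, t - t) \<in> contact_rel m j Z W" by (rule contact_rel_diff[OF Z W t])
    then show "x \<in> S_seq m Z W (Suc j)" by (simp add: S)
  next
    fix x assume "x \<in> S_seq m Z W (Suc j)"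
    then have x: "(x, 0) \<in> contact_rel m j Z W" by (simp add: S)
    have "x \<in> U" using x by (force simp: U)
    moreover have "contact_form m j Z W (x, y) = 0" if "y \<in> U" for y
      using that contact_form_eq[OF x] by (auto simp: U)
    ultimately show "x \<in> form_kernel U (restrict (contact_form m j Z W) (U \<times> U))"
      by (simp add: form_kernel_def)
  qed
qed

end

section \<open>Isometries congruent to the identity\<close>

lemma red_vec_unit_vec [simp]: "red_vec (unit_vec k) = unit_vec k"
  by (auto simp: red_vec_def unit_vec_def)

lemma quad_form_unit_vec: "quad_form m (unit_vec k) = 0"
  unfolding quad_form_def by (rule sum.neutral) (auto simp: unit_vec_def)

lemma polar_unit_vec_left: "k < 2 * m \<Longrightarrow> polar m (unit_vec k) x = x (opp m k)"
  by (simp add: polar_commute[of m "unit_vec k"] polar_unit_vec)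

text \<open>The exterior product of the \<open>i\<close>-th and \<open>k\<close>-th coordinate
  functionals; these span the alternating forms on the coordinate space.\<close>

definition wedge :: "nat \<Rightarrow> nat \<Rightarrow> (nat \<Rightarrow> 'a :: comm_ring_1) \<times> (nat \<Rightarrow> 'a) \<Rightarrow> 'a" where
  "wedge i k = (\<lambda>(x, y). x i * y k - x k * y i)"

text \<open>Isometries \<open>1 + \<ell>\<^sup>j N\<close> of \<open>V\<close> for which the form \<open>polar (N x) y\<close> reduces to \<open>A\<close> modulo \<open>\<ell>\<close>.\<close>

definition cong_isometry :: "nat \<Rightarrow> nat \<Rightarrow> ((nat \<Rightarrow> 'p mod_ring) \<times> (nat \<Rightarrow> 'p mod_ring) \<Rightarrow> 'p mod_ring) \<Rightarrow>
    ((nat \<Rightarrow> 'p :: prime_card adic_int) \<Rightarrow> nat \<Rightarrow> 'p adic_int) \<Rightarrow> bool" where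
  "cong_isometry m j A g \<longleftrightarrow> module_hom smul smul g \<and> inj g \<and> g ` V_adic m = V_adic m \<and>
     (\<forall>v. quad_form m (g v) = quad_form m v) \<and>
     (\<exists>N. \<forall>v\<in>V_adic m. g v = v + smul (ell ^ j) (N v) \<and> N v \<in> V_adic m \<and>
        (\<forall>y. polar m (red_vec (N v)) y = A (red_vec v, y)))"

text \<open>An Eichler transformation. The index conditions make the unit vectors at
  \<open>opp m i\<close> and \<open>opp m k\<close> span a totally isotropic plane on which
  \<open>M\<close> vanishes, so \<open>M\<close> squares to 0 and \<open>M v\<close> is singular and
  orthogonal to \<open>v\<close>; hence adding a multiple of \<open>M\<close> is a unipotent
  isometry.\<close>

lemma cong_isometry_eichler:
  fixes c :: int
  assumes ik: "i < 2 * m" "k < 2 * m" "i \<noteq> k" "k \<noteq> opp m i"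
  shows "\<exists>g. cong_isometry m j (\<lambda>p. of_int c * wedge i k p :: 'p :: prime_card mod_ring) g"
proof -
  \<comment> \<open>Opposite indices appear because pairing with the unit vector at
    \<open>opp m k\<close> extracts coordinate \<open>k\<close>; thus \<open>polar m (M v) y\<close>
    is the wedge of \<open>v\<close> and \<open>y\<close>.\<close>
  define M :: "(nat \<Rightarrow> 'p adic_int) \<Rightarrow> nat \<Rightarrow> 'p adic_int" where
    "M v = smul (v i) (unit_vec (opp m k)) - smul (v k) (unit_vec (opp m i))" for v
  have ne: "i \<noteq> opp m k" using ik opp_opp[of k m] by auto
  note opps = opp_less opp_opp ik ne ne[symmetric] opp_neq opp_neq[symmetric]
  have M_add: "M (x + y) = M x + M y" for x y
    by (simp add: M_def fmod.scale_left_distrib)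
  have M_smul: "M (smul a x) = smul a (M x)" for a x
    by (simp add: M_def fmod.scale_right_diff_distrib) (simp add: smul_def)
  have M_V: "M v \<in> V_adic m" for v
    using opps by (auto simp: M_def intro!: coord_space_closed unit_vec_coord_space)
  have Mi: "M v i = 0" "M v k = 0" for v
    using opps by (auto simp: M_def smul_def unit_vec_def)
  have MM: "M (M v) = 0" for v by (simp add: M_def[of "M v"] Mi)
  have MQ: "quad_form m (M v) = 0" for v
    using opps by (simp add: M_def quad_form_diff quad_form_smul quad_form_unit_vec polar_linear polar_unit_vec)
      (simp add: unit_vec_def)
  have vM: "polar m v (M v) = 0" for v
    using opps by (simp add: M_def polar_linear polar_unit_vec)
  define g where "g a v = v + smul (ell ^ j) (smul a (M v))" for a v
  have g_inv: "g (- a) (g a v) = v" for a v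
    by (simp add: g_def M_add M_smul MM)
  have g_V: "g a v \<in> V_adic m" if "v \<in> V_adic m" for a v
    unfolding g_def using that by (intro coord_space_closed M_V)
  have "cong_isometry m j (\<lambda>p. of_int c * wedge i k p) (g (of_int c))"
    unfolding cong_isometry_def
  proof (intro conjI)
    show "module_hom smul smul (g (of_int c))"
      by unfold_locales (simp_all add: g_def M_add M_smul fmod.scale_right_distrib algebra_simps)
    show "inj (g (of_int c))"
      by (rule inj_on_inverseI) (rule g_inv)
    show "g (of_int c) ` V_adic m = V_adic m"
    proof (intro equalityI subsetI)
      fix v :: "nat \<Rightarrow> 'p adic_int" assume v: "v \<in> V_adic m"
      then show "v \<in> g (of_int c) ` V_adic m"
        using g_inv[of "- of_int c" v] g_V[OF v, of "- of_int c"] by (intro image_eqI[where x = "g (- of_int c) v"]) simp_all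
    qed (auto intro: g_V)
    show "\<forall>v. quad_form m (g (of_int c) v) = quad_form m v"
      by (simp add: g_def quad_form_add quad_form_smul MQ polar_linear vM)
    have "polar m (red_vec (smul (of_int c) (M v))) y = of_int c * wedge i k (red_vec v, y)" for v y
      using opps by (simp add: M_def polar_linear polar_unit_vec_left wedge_def)
        (simp add: red_vec_def)
    then show "\<exists>N. \<forall>v\<in>V_adic m. g (of_int c) v = v + smul (ell ^ j) (N v) \<and> N v \<in> V_adic m \<and>
        (\<forall>y. polar m (red_vec (N v)) y = of_int c * wedge i k (red_vec v, y))"
      using M_V by (intro exI[of _ "\<lambda>v. smul (of_int c) (M v)"] ballI conjI allI)
        (auto simp only: g_def intro!: coord_space_closed)
  qed
  then show ?thesis by blast
qed

text \<open>For the remaining index pair the two unit vectors form a hyperbolic plane, so a diagonal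
  isometry is used instead: one coordinate is scaled by a unit congruent to 1 and its partner by the
  inverse.\<close>

lemma cong_isometry_torus:
  fixes c :: int
  assumes i: "i < m" and j: "j \<ge> 1"
  shows "\<exists>g. cong_isometry m j (\<lambda>p. of_int c * wedge i (m + i) p :: 'p :: prime_card mod_ring) g"
proof -
  define a :: "'p adic_int" where "a = 1 + ell ^ j * of_int c"
  obtain u :: "'p adic_int" where "(1 + of_int (int CARD('p) ^ j * c)) * u = 1"
    using one_plus_ell_multiple_invertible[of "int CARD('p) ^ j * c", where 'p = 'p] j by auto
  then have au: "a * u = 1" by (simp add: a_def)
  then have ua: "u * a = 1" by (simp add: mult.commute)
  define g where "g a u v = v(i := a * v i, m + i := u * v (m + i))"
    for a u :: "'p adic_int" and v :: "nat \<Rightarrow> 'p adic_int"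
  have g_inv: "g u a (g a u v) = v" if "u * a = 1" "a * u = 1" for a u v
    using i that by (auto simp: g_def fun_eq_iff mult.assoc[symmetric])
  have g_V: "g a u v \<in> V_adic m" if "v \<in> V_adic m" for a u v
    using that i by (auto simp: g_def coord_space_def)
  \<comment> \<open>The two coefficients are \<open>a - 1\<close> and \<open>u - 1\<close> divided
    by \<open>ell ^ j\<close>; the second equals minus \<open>u\<close> times the first, and
    \<open>u\<close> reduces to 1.\<close>
  define N where "N v = smul (of_int c) (smul (v i) (unit_vec i) - smul (u * v (m + i)) (unit_vec (m + i)))" for v
  have "adic_red (a * u) = 1" by (simp add: au)
  then have red_u: "adic_red u = 1" using j by (simp add: a_def power_0_left)
  have u_eq: "u = 1 - ell ^ j * of_int c * u" using au by (simp add: a_def algebra_simps)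
  have gN: "g a u v = v + smul (ell ^ j) (N v)" for v
  proof
    fix l
    have "u * v (m + i) = v (m + i) - ell ^ j * of_int c * u * v (m + i)"
      using arg_cong[OF u_eq, of "\<lambda>b. b * v (m + i)"] by (simp add: algebra_simps)
    then show "g a u v l = (v + smul (ell ^ j) (N v)) l"
      using i by (simp add: g_def N_def smul_def unit_vec_def a_def algebra_simps)
  qed
  have "cong_isometry m j (\<lambda>p. of_int c * wedge i (m + i) p) (g a u)"
    unfolding cong_isometry_def
  proof (intro conjI)
    show "module_hom smul smul (g a u)"
      by unfold_locales (auto simp: g_def fun_eq_iff smul_def algebra_simps)
    show "inj (g a u)"
      by (rule inj_on_inverseI) (rule g_inv[OF ua au])
    show "g a u ` V_adic m = V_adic m"
    proof (intro equalityI subsetI)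
      fix v :: "nat \<Rightarrow> 'p adic_int" assume v: "v \<in> V_adic m"
      then show "v \<in> g a u ` V_adic m"
        using g_inv[OF au ua, of v] g_V[OF v, of u a] by (intro image_eqI[where x = "g u a v"]) simp_all
    qed (auto intro: g_V)
    show "\<forall>v. quad_form m (g a u v) = quad_form m v"
    proof
      fix v
      have "a * v i * (u * v (m + i)) = (a * u) * (v i * v (m + i))" by (simp add: algebra_simps)
      then have "a * v i * (u * v (m + i)) = v i * v (m + i)" by (simp add: au)
      then show "quad_form m (g a u v) = quad_form m v"
        unfolding quad_form_def using i by (intro sum.cong) (auto simp: g_def)
    qed
    have "polar m (red_vec (N v)) y = of_int c * wedge i (m + i) (red_vec v, y)" for v y
      using i by (simp add: N_def polar_linear polar_unit_vec_left wedge_def opp_def red_u)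
        (simp add: red_vec_def)
    moreover have "N v \<in> V_adic m" for v
      unfolding N_def using i by (intro coord_space_closed unit_vec_coord_space) auto
    ultimately show "\<exists>N. \<forall>v\<in>V_adic m. g a u v = v + smul (ell ^ j) (N v) \<and> N v \<in> V_adic m \<and>
        (\<forall>y. polar m (red_vec (N v)) y = of_int c * wedge i (m + i) (red_vec v, y))"
      using gN by blast
  qed
  then show ?thesis by blast
qed

lemma cong_isometry_wedge:
  fixes c :: "'p :: prime_card mod_ring"
  assumes "i < k" "k < 2 * m" "j \<ge> 1"
  shows "\<exists>g. cong_isometry m j (\<lambda>p. c * wedge i k p) g"
proof -
  have c: "c = of_int (to_int_mod_ring c)" by (simp add: of_int_of_int_mod_ring)
  show ?thesis
  proof (cases "k = opp m i")
    case True
    then have "i < m" "k = m + i" using assms by (auto simp: opp_def split: if_splits)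
    then show ?thesis using cong_isometry_torus[of i m j "to_int_mod_ring c"] assms c by metis
  next
    case False
    then show ?thesis using cong_isometry_eichler[of i m k j "to_int_mod_ring c"] assms c
      by (metis less_irrefl_nat order_less_trans)
  qed
qed

context
  fixes m j :: nat and A and g :: "(nat \<Rightarrow> 'p :: prime_card adic_int) \<Rightarrow> nat \<Rightarrow> 'p adic_int"
  assumes g: "cong_isometry m j A g"
begin

lemma cong_isometry_hom: "module_hom smul smul g"
  using g by (simp add: cong_isometry_def)

lemma cong_isometry_image_OGr:
  assumes "W \<in> OGr m"
  shows "g ` W \<in> OGr m"
proof -
  interpret g: module_hom smul smul g by (rule cong_isometry_hom)
  have inj: "inj g" and V: "g ` V_adic m = V_adic m" and Q: "\<And>v. quad_form m (g v) = quad_form m v"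
    using g by (auto simp: cong_isometry_def)
  obtain N B where W: "fmod.subspace W" "W \<subseteq> V_adic m" "fmod.subspace N" "N \<subseteq> V_adic m"
      "W \<inter> N = {0}" "W + N = V_adic m" and B: "finite B" "card B = m" "\<not> fmod.dependent B" "fmod.span B = W"
      and Q0: "\<forall>w\<in>W. quad_form m w = 0"
    using assms by (auto simp: OGr_def direct_summand_def free_of_rank_def)
  have "g ` W \<inter> g ` N = {0}"
    using image_Int[OF inj, of W N] W(5) g.zero by simp
  moreover have "g ` W + g ` N = V_adic m"
  proof -
    have "g ` W + g ` N = g ` (W + N)"
      by (auto simp: g.add image_iff elim!: set_plus_elim intro!: set_plus_intro)
        (metis g.add set_plus_intro)
    then show ?thesis by (simp add: W V)
  qed
  ultimately have "direct_summand (V_adic m) (g ` W)"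
    unfolding direct_summand_def using W V
    by (intro conjI exI[of _ "g ` N"] g.subspace_image) (simp_all, metis image_mono, metis image_mono)
  moreover have "free_of_rank (g ` W) m"
    unfolding free_of_rank_def
    using B inj g.span_image[of B] g.independent_inj_image[of B]
    by (intro exI[of _ "g ` B"]) (simp add: card_image inj_on_subset)
  ultimately show ?thesis by (simp add: OGr_def Q Q0)
qed

lemma cong_isometry_ell_pow_V: "g ` ell_pow_V m e = ell_pow_V m e"
proof -
  interpret g: module_hom smul smul g by (rule cong_isometry_hom)
  have "g ` ell_pow_V m e = smul (ell ^ e) ` g ` V_adic m"
    by (simp add: ell_pow_V_def image_image g.scale)
  then show ?thesis using g by (simp add: cong_isometry_def ell_pow_V_def)
qed

text \<open>This makes the action of \<open>g\<close> on members of \<open>OGr\<close> descend to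
  their reductions at every level, where it is still injective.\<close>

lemma cong_isometry_image_mod: "image_mod m e (g ` W) = (`) g ` image_mod m e W"
proof -
  interpret g: module_hom smul smul g by (rule cong_isometry_hom)
  have "g v +o ell_pow_V m e = g ` (v +o ell_pow_V m e)" for v
  proof -
    have "g ` (v +o ell_pow_V m e) = g v +o (g ` ell_pow_V m e)"
      by (force simp: elt_set_plus_def g.add)
    then show ?thesis by (simp add: cong_isometry_ell_pow_V)
  qed
  then show ?thesis by (simp add: image_mod_def image_image)
qed

lemma cong_isometry_image_mod_level:
  assumes "W \<in> OGr m"
  shows "image_mod m j (g ` W) = image_mod m j W"
proof -
  obtain N where N: "\<And>v. v \<in> V_adic m \<Longrightarrow> g v = v + smul (ell ^ j) (N v) \<and> N v \<in> V_adic m"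
    using g unfolding cong_isometry_def by blast
  have "g w +o ell_pow_V m j = w +o ell_pow_V m j" if "w \<in> W" for w
  proof -
    have "w \<in> V_adic m" using that OGr_subset[OF assms] by blast
    then show ?thesis unfolding coset_eq_iff using N[of w] by (simp add: ell_pow_V_def)
  qed
  then show ?thesis by (simp add: image_mod_def image_image)
qed

text \<open>Replacing \<open>w\<close> by \<open>g w\<close> changes
  \<open>(w - z) / ell ^ j\<close> by \<open>N w\<close>, so the partner of \<open>x\<close> is
  shifted by the reduction of \<open>N w\<close>, which pairs as \<open>A\<close>. The vector
  \<open>x\<close> itself does not move because \<open>j \<ge> 1\<close>.\<close>

lemma contact_form_cong_isometry:
  assumes Z: "Z \<in> OGr m" and W: "W \<in> OGr m" and j: "j \<ge> 1"
    and xy: "x \<in> S_seq m Z W j" "y \<in> S_seq m Z W j"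
  shows "contact_form m j Z (g ` W) (x, y) = contact_form m j Z W (x, y) + A (x, y)"
proof -
  obtain N where N: "\<And>v. v \<in> V_adic m \<Longrightarrow> g v = v + smul (ell ^ j) (N v) \<and> N v \<in> V_adic m \<and>
      (\<forall>y. polar m (red_vec (N v)) y = A (red_vec v, y))"
    using g unfolding cong_isometry_def by blast
  have shift: "\<exists>r. (x, t + r) \<in> contact_rel m j Z (g ` W) \<and> (\<forall>y. polar m r y = A (x, y))"
    if xt: "(x, t) \<in> contact_rel m j Z W" for x t
  proof -
    obtain w z u where w: "x = red_vec w" "t = red_vec u" "w \<in> W" "z \<in> Z" "u \<in> V_adic m" "w - z = smul (ell ^ j) u"
      using xt by (rule contact_relE)
    have wV: "w \<in> V_adic m" using w OGr_subset[OF W] by blast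
    have uN: "u + N w \<in> V_adic m" using N[OF wV] w(5) by (simp add: coord_space_closed)
    have "g w - z = (w - z) + smul (ell ^ j) (N w)" using N[OF wV] by simp
    also have "\<dots> = smul (ell ^ j) (u + N w)" by (simp add: w fmod.scale_right_distrib)
    finally have "(red_vec (g w), red_vec (u + N w)) \<in> contact_rel m j Z (g ` W)"
      by (rule contact_relI[OF imageI[OF w(3)] w(4) uN])
    moreover have "red_vec (g w) = x" using N[OF wV] j by (simp add: w power_0_left)
    ultimately have "(x, t + red_vec (N w)) \<in> contact_rel m j Z (g ` W)" by (simp only: w(2) red_vec_simps)
    then show ?thesis using N[OF wV] w(1) by blast
  qed
  obtain t s where ts: "(x, t) \<in> contact_rel m j Z W" "(y, s) \<in> contact_rel m j Z W"
    using xy by (auto simp: S_seq_eq_contact_rel[OF j])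
  obtain r where r: "(x, t + r) \<in> contact_rel m j Z (g ` W)" "\<And>y. polar m r y = A (x, y)"
    using shift[OF ts(1)] by blast
  obtain r' where "(y, s + r') \<in> contact_rel m j Z (g ` W)" using shift[OF ts(2)] by blast
  then show ?thesis
    using contact_form_eq[OF Z W j ts] contact_form_eq[OF Z cong_isometry_image_OGr[OF W] j r(1)]
    by (simp add: polar_linear r(2))
qed

end

section \<open>Counting pairs with a prescribed form\<close>

text \<open>By induction on \<open>n\<close>: the new row and the new column combine into the
  antisymmetrised terms, and the new diagonal entry vanishes.\<close>

lemma sum_square_alternating:
  fixes b :: "nat \<Rightarrow> nat \<Rightarrow> 'a :: comm_ring_1"
  assumes "\<And>i. b i i = 0" "\<And>i k. b k i = - b i k"
  shows "(\<Sum>i<n. \<Sum>k<n. x i * y k * b i k) = (\<Sum>k<n. \<Sum>i<k. b i k * (x i * y k - x k * y i))"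
proof (induction n)
  case (Suc n)
  have "(\<Sum>i<Suc n. \<Sum>k<Suc n. x i * y k * b i k)
      = (\<Sum>i<n. \<Sum>k<n. x i * y k * b i k) + ((\<Sum>i<n. x i * y n * b i n) + (\<Sum>k<n. x n * y k * b n k))"
    by (simp add: sum.distrib assms(1))
  also have "(\<Sum>i<n. x i * y n * b i n) + (\<Sum>k<n. x n * y k * b n k)
      = (\<Sum>i<n. b i n * (x i * y n - x n * y i))"
    unfolding sum.distrib[symmetric] assms(2)[of n] by (simp add: algebra_simps)
  finally show ?case using Suc by simp
qed simp

lemma coord_space_expansion:
  fixes x :: "nat \<Rightarrow> 'a :: comm_ring_1"
  assumes "x \<in> coord_space n"
  shows "x = (\<Sum>i<n. smul (x i) (unit_vec i))"
proof
  fix l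
  have "(\<Sum>i<n. smul (x i) (unit_vec i)) l = (\<Sum>i<n. if l = i then x i else 0)"
    by (induction n) (simp_all add: smul_def unit_vec_def)
  also have "\<dots> = x l" using assms by (simp add: coord_space_def)
  finally show "x l = (\<Sum>i<n. smul (x i) (unit_vec i)) l" by simp
qed

text \<open>An alternating form on \<open>U\<close> extends to the whole space along a linear projection onto \<open>U\<close>.\<close>

lemma alternating_form_wedge_sum:
  fixes U :: "(nat \<Rightarrow> 'a :: field) set"
  assumes B: "B \<in> alternating_forms U" and U: "fmod.subspace U" "U \<subseteq> coord_space n"
  shows "\<exists>a. \<forall>x\<in>U. \<forall>y\<in>U. B (x, y) = (\<Sum>k<n. \<Sum>i<k. a i k * wedge i k (x, y))"
proof -
  interpret vs: vector_space_pair "smul :: 'a \<Rightarrow> (nat \<Rightarrow> 'a) \<Rightarrow> _" "smul :: 'a \<Rightarrow> (nat \<Rightarrow> 'a) \<Rightarrow> _"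
    by unfold_locales
  have addl: "B (x + y, z) = B (x, z) + B (y, z)" and addr: "B (z, x + y) = B (z, x) + B (z, y)"
    if "x \<in> U" "y \<in> U" "z \<in> U" for x y z
    using B that unfolding alternating_forms_def by blast+
  have scalel: "B (smul c x, y) = c * B (x, y)" and scaler: "B (x, smul c y) = c * B (x, y)"
    if "x \<in> U" "y \<in> U" for c x y
    using B that unfolding alternating_forms_def by blast+
  have alt: "B (x, x) = 0" if "x \<in> U" for x using B that unfolding alternating_forms_def by blast
  have zero: "B (0, y) = 0" if "y \<in> U" for y
    using scalel[OF fmod.subspace_0[OF U(1)] that, of 0] by simp
  have skew: "B (y, x) = - B (x, y)" if xy: "x \<in> U" "y \<in> U" for x y
  proof -
    have "B (x + y, x + y) = 0" by (rule alt) (rule fmod.subspace_add[OF U(1) xy])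
    moreover have "B (x + y, x + y) = B (x, x) + B (x, y) + (B (y, x) + B (y, y))"
      using addl[OF xy fmod.subspace_add[OF U(1) xy]] addr[OF xy xy(1)] addr[OF xy xy(2)] by simp
    ultimately show ?thesis using alt[OF xy(1)] alt[OF xy(2)] by (simp add: add_eq_0_iff)
  qed
  \<comment> \<open>The projection is a linear left inverse of the inclusion of
    \<open>U\<close>.\<close>
  obtain p where p: "range p \<subseteq> U" "Vector_Spaces.linear smul smul p" "\<And>v. v \<in> U \<Longrightarrow> p v = v"
  proof -
    have "Vector_Spaces.linear smul smul (\<lambda>v :: nat \<Rightarrow> 'a. v)" by unfold_locales simp_all
    from vs.linear_exists_left_inverse_on[OF this U(1) inj_on_id2] show ?thesis
      using that by blast
  qed
  interpret p: Vector_Spaces.linear smul smul p by (rule p(2))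
  \<comment> \<open>The \<open>e i\<close> need not be independent, but every \<open>x\<close> in
    \<open>U\<close> is their combination with its own coordinates as coefficients, which is all
    that the expansion requires.\<close>
  define e where "e i = p (unit_vec i)" for i
  have eU: "e i \<in> U" for i using p(1) by (auto simp: e_def)
  have expand: "x = (\<Sum>i<n. smul (x i) (e i))" if x: "x \<in> U" for x
  proof -
    have "x = p (\<Sum>i<n. smul (x i) (unit_vec i))"
      using p(3)[OF x] coord_space_expansion[of x n] x U(2) by auto
    also have "\<dots> = (\<Sum>i<n. smul (x i) (e i))" by (simp only: p.sum p.scale e_def)
    finally show ?thesis .
  qed
  have sumU: "(\<Sum>i\<in>I. smul (c i) (e i)) \<in> U" for I :: "nat set" and c
    by (intro fmod.subspace_sum[OF U(1)] fmod.subspace_scale[OF U(1)] eU)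
  have Bl: "B (\<Sum>i<l. smul (c i) (e i), y) = (\<Sum>i<l. c i * B (e i, y))" if y: "y \<in> U" for l c y
  proof (induction l)
    case 0
    show ?case using zero[OF y] by (simp only: lessThan_0 sum.empty)
  next
    case (Suc l)
    show ?case
      using Suc addl[OF sumU fmod.subspace_scale[OF U(1) eU] y] scalel[OF eU y]
      by (simp only: sum.lessThan_Suc)
  qed
  have Br: "B (x, \<Sum>i<l. smul (c i) (e i)) = (\<Sum>i<l. c i * B (x, e i))" if x: "x \<in> U" for l c x
    using Bl[OF x, of c l] skew[OF x sumU] skew[OF x eU] by (simp add: sum_negf)
  show ?thesis
  proof (intro exI ballI)
    fix x y assume x: "x \<in> U" and y: "y \<in> U"
    have "B (x, y) = B (\<Sum>i<n. smul (x i) (e i), y)"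
      by (rule arg_cong[OF expand[OF x], of "\<lambda>v. B (v, y)"])
    also have "\<dots> = (\<Sum>i<n. x i * B (e i, y))" by (rule Bl[OF y])
    also have "\<dots> = (\<Sum>i<n. x i * B (e i, \<Sum>k<n. smul (y k) (e k)))"
      by (rule arg_cong[OF expand[OF y], of "\<lambda>v. \<Sum>i<n. x i * B (e i, v)"])
    also have "\<dots> = (\<Sum>i<n. \<Sum>k<n. x i * y k * B (e i, e k))"
      by (simp add: Br[OF eU] sum_distrib_left mult.assoc)
    also have "\<dots> = (\<Sum>k<n. \<Sum>i<k. B (e i, e k) * (x i * y k - x k * y i))"
      by (rule sum_square_alternating) (rule alt[OF eU], rule skew[OF eU eU])
    finally show "B (x, y) = (\<Sum>k<n. \<Sum>i<k. B (e i, e k) * wedge i k (x, y))"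
      by (simp add: wedge_def)
  qed
qed

section \<open>Reductions modulo powers of the prime and pairs of them\<close>

lemma image_mod_subset_iff:
  "image_mod m e X \<subseteq> image_mod m e Y \<longleftrightarrow> (\<forall>x\<in>X. \<exists>y\<in>Y. x - y \<in> ell_pow_V m e)"
  by (auto simp: image_mod_def coset_eq_iff[symmetric] image_subset_iff image_iff)

lemma ell_pow_V_antimono: "d \<le> e \<Longrightarrow> ell_pow_V m e \<subseteq> ell_pow_V m d"
proof
  fix x :: "nat \<Rightarrow> 'p :: prime_card adic_int"
  assume "d \<le> e" "x \<in> ell_pow_V m e"
  then obtain u where "u \<in> V_adic m" "x = smul (ell ^ d) (smul (ell ^ (e - d)) u)"
    by (auto simp: ell_pow_V_def power_add[symmetric])
  then show "x \<in> ell_pow_V m d"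
    unfolding ell_pow_V_def by (intro image_eqI[where x = "smul (ell ^ (e - d)) u"] coord_space_closed)
qed

lemma image_mod_mono_level:
  assumes "image_mod m e X = image_mod m e Y" "d \<le> e"
  shows "image_mod m d X = image_mod m d Y"
proof -
  have "image_mod m d X \<subseteq> image_mod m d Y" if "image_mod m e X \<subseteq> image_mod m e Y" for X Y
    using that ell_pow_V_antimono[OF assms(2), of m] unfolding image_mod_subset_iff by blast
  then show ?thesis using assms(1) by blast
qed

text \<open>One level beyond \<open>j\<close> suffices: changing \<open>w\<close> and
  \<open>z\<close> within their cosets at level \<open>Suc j\<close> changes \<open>t\<close> by a
  multiple of \<open>ell\<close>, invisible after reduction.\<close>

lemma contact_rel_cong_image_mod:
  assumes "image_mod m (Suc j) Z = image_mod m (Suc j) Z'" "image_mod m (Suc j) W = image_mod m (Suc j) W'"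
  shows "contact_rel m j Z W = contact_rel m j Z' W'"
proof -
  have "contact_rel m j Z W \<subseteq> contact_rel m j Z' W'"
    if sub: "image_mod m (Suc j) Z \<subseteq> image_mod m (Suc j) Z'" "image_mod m (Suc j) W \<subseteq> image_mod m (Suc j) W'"
    for Z W Z' W'
  proof
    fix p assume "p \<in> contact_rel m j Z W"
    then obtain w z t where p: "p = (red_vec w, red_vec t)" "w \<in> W" "z \<in> Z" "t \<in> V_adic m"
        "w - z = smul (ell ^ j) t"
      by (cases p) (auto elim: contact_relE)
    obtain w' where w': "w' \<in> W'" "w - w' \<in> ell_pow_V m (Suc j)"
      using sub(2) p(2) unfolding image_mod_subset_iff by blast
    obtain z' where z': "z' \<in> Z'" "z - z' \<in> ell_pow_V m (Suc j)"
      using sub(1) p(3) unfolding image_mod_subset_iff by blast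
    have "(z - z') - (w - w') \<in> ell_pow_V m (Suc j)"
      using z'(2) w'(2) by (rule ell_pow_V_closed)
    then obtain u where u: "u \<in> V_adic m" "(z - z') - (w - w') = smul (ell ^ Suc j) u"
      by (auto simp: ell_pow_V_def)
    have "w' - z' = (w - z) + ((z - z') - (w - w'))" by simp
    also have "\<dots> = smul (ell ^ j) t + smul (ell ^ Suc j) u" by (simp only: p(5) u(2))
    also have "\<dots> = smul (ell ^ j) (t + smul ell u)" by (simp add: fmod.scale_right_distrib mult.commute)
    finally have "(red_vec w', red_vec (t + smul ell u)) \<in> contact_rel m j Z' W'"
      by (intro contact_relI[OF w'(1) z'(1)] coord_space_closed p(4) u(1))
    moreover have "red_vec (w - w') = 0" using w'(2) by (rule red_vec_ell_pow_V) simp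
    ultimately show "p \<in> contact_rel m j Z' W'" by (simp add: p(1))
  qed
  then show ?thesis using assms by (metis subset_antisym order_refl)
qed

text \<open>A pair of reductions counts as soon as some lift satisfies \<open>R\<close>; when
  \<open>R\<close> depends only on the reductions at level \<open>e\<close>, every lift then
  does.\<close>

definition img_pairs :: "nat \<Rightarrow> nat \<Rightarrow> ((nat \<Rightarrow> 'p :: prime_card adic_int) set \<Rightarrow> (nat \<Rightarrow> 'p adic_int) set \<Rightarrow> bool) \<Rightarrow>
    ((nat \<Rightarrow> 'p adic_int) set set \<times> (nat \<Rightarrow> 'p adic_int) set set) set" where
  "img_pairs m e R = {(image_mod m e Z, image_mod m e W) | Z W. Z \<in> OGr m \<and> W \<in> OGr m \<and> R Z W}"

lemma img_pairs_subset: "img_pairs m e R \<subseteq> (image_mod m e ` OGr m) \<times> (image_mod m e ` OGr m)"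
  by (auto simp: img_pairs_def)

lemma img_pairs_cong:
  "(\<And>Z W. Z \<in> OGr m \<Longrightarrow> W \<in> OGr m \<Longrightarrow> R Z W = R' Z W) \<Longrightarrow> img_pairs m e R = img_pairs m e R'"
  unfolding img_pairs_def by (intro Collect_cong) metis

context
  fixes m j :: nat and R :: "(nat \<Rightarrow> 'p :: prime_card adic_int) set \<Rightarrow> (nat \<Rightarrow> 'p adic_int) set \<Rightarrow> bool"
    and U :: "(nat \<Rightarrow> 'p mod_ring) set"
  assumes j: "j \<ge> 1" and fin: "finite (image_mod m (Suc j) ` (OGr m :: (nat \<Rightarrow> 'p adic_int) set set))"
    and R_cong: "\<And>Z W W'. Z \<in> OGr m \<Longrightarrow> W \<in> OGr m \<Longrightarrow> W' \<in> OGr m \<Longrightarrow>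
      image_mod m j W = image_mod m j W' \<Longrightarrow> R Z W = R Z W'"
    and R_S: "\<And>Z W. Z \<in> OGr m \<Longrightarrow> W \<in> OGr m \<Longrightarrow> R Z W \<Longrightarrow> S_seq m Z W j = U"
begin

abbreviation form_pairs where
  "form_pairs B \<equiv> img_pairs m (Suc j) (\<lambda>Z W. R Z W \<and> (\<forall>x\<in>U. \<forall>y\<in>U. contact_form m j Z W (x, y) = B (x, y)))"

lemma finite_img_pairs:
  fixes R' :: "(nat \<Rightarrow> 'p adic_int) set \<Rightarrow> (nat \<Rightarrow> 'p adic_int) set \<Rightarrow> bool"
  shows "finite (img_pairs m (Suc j) R')"
  by (rule finite_subset[OF img_pairs_subset]) (simp add: fin)

text \<open>Moving \<open>W\<close> to \<open>g W\<close> is injective on reductions, preserves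
  \<open>R\<close> because \<open>g\<close> is the identity at level \<open>j\<close>, and adds
  \<open>A\<close> to the contact form.\<close>

lemma card_form_pairs_isometry:
  assumes g: "cong_isometry m j A g"
  shows "card (form_pairs B) \<le> card (form_pairs (\<lambda>p. B p + A p))"
proof (rule card_inj_on_le[OF _ _ finite_img_pairs])
  \<comment> \<open>A reduction is a set of cosets and a coset is a set of vectors, so injectivity
    is passed through direct images twice.\<close>
  have "inj g" using g by (simp add: cong_isometry_def)
  then have "inj ((`) g)" by (simp only: inj_image_eq_iff inj_on_def simp_thms) simp
  then have "inj ((`) ((`) g))" by (simp only: inj_image_eq_iff inj_on_def simp_thms) simp
  then have "inj (map_prod id ((`) ((`) g)))" by (rule prod.inj_map[OF inj_on_id])
  then show "inj_on (map_prod id ((`) ((`) g))) (form_pairs B)"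
    by (rule inj_on_subset) simp
  show "map_prod id ((`) ((`) g)) ` form_pairs B \<subseteq> form_pairs (\<lambda>p. B p + A p)"
  proof
    fix q assume "q \<in> map_prod id ((`) ((`) g)) ` form_pairs B"
    then obtain Z W where q: "q = (image_mod m (Suc j) Z, (`) g ` image_mod m (Suc j) W)" and
        ZW: "Z \<in> OGr m" "W \<in> OGr m" "R Z W" and
        B: "\<forall>x\<in>U. \<forall>y\<in>U. contact_form m j Z W (x, y) = B (x, y)"
      unfolding img_pairs_def by auto
    note gW = cong_isometry_image_OGr[OF g ZW(2)]
    have "R Z (g ` W)"
      using R_cong[OF ZW(1,2) gW] cong_isometry_image_mod_level[OF g ZW(2)] ZW(3) by simp
    moreover have "contact_form m j Z (g ` W) (x, y) = B (x, y) + A (x, y)" if "x \<in> U" "y \<in> U" for x y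
      using contact_form_cong_isometry[OF g ZW(1,2) j] R_S[OF ZW] that B by simp
    moreover have "q = (image_mod m (Suc j) Z, image_mod m (Suc j) (g ` W))"
      by (simp add: q cong_isometry_image_mod[OF g])
    ultimately show "q \<in> form_pairs (\<lambda>p. B p + A p)"
      using ZW(1) gW unfolding img_pairs_def by blast
  qed
qed

text \<open>The hypothesis ranges over all base forms \<open>B\<close>, so that the shifts can be
  chained one after another.\<close>

lemma card_form_pairs_sum:
  assumes "finite K" "\<And>k B. k \<in> K \<Longrightarrow> card (form_pairs B) \<le> card (form_pairs (\<lambda>p. B p + f k p))"
  shows "card (form_pairs B) \<le> card (form_pairs (\<lambda>p. B p + (\<Sum>k\<in>K. f k p)))"
  using assms
proof (induction K arbitrary: B rule: finite_induct)
  case (insert k K)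
  have "card (form_pairs B) \<le> card (form_pairs (\<lambda>p. B p + f k p))" by (rule insert) simp
  also have "\<dots> \<le> card (form_pairs (\<lambda>p. (B p + f k p) + (\<Sum>k\<in>K. f k p)))"
    by (rule insert.IH) (rule insert.prems, simp)
  finally show ?case using insert(1,2) by (simp add: add.assoc)
qed simp

text \<open>On \<open>U\<close> the difference of \<open>C\<close> and \<open>B\<close> is a
  combination of wedges, each realised by an isometry; these carry \<open>B\<close> to
  \<open>C\<close> one wedge at a time.\<close>

lemma card_form_pairs_le:
  assumes U: "fmod.subspace U" "U \<subseteq> V_mod m"
    and B: "B \<in> alternating_forms U" and C: "C \<in> alternating_forms U"
  shows "card (form_pairs B) \<le> card (form_pairs C)"
proof -
  obtain a where a: "\<forall>x\<in>U. \<forall>y\<in>U. B (x, y) = (\<Sum>k<2 * m. \<Sum>i<k. a i k * wedge i k (x, y))"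
    using alternating_form_wedge_sum[OF B U] by blast
  obtain b where b: "\<forall>x\<in>U. \<forall>y\<in>U. C (x, y) = (\<Sum>k<2 * m. \<Sum>i<k. b i k * wedge i k (x, y))"
    using alternating_form_wedge_sum[OF C U] by blast
  let ?A = "\<lambda>p. \<Sum>k<2 * m. \<Sum>i<k. (b i k - a i k) * wedge i k p"
  have "card (form_pairs B) \<le> card (form_pairs (\<lambda>p. B p + ?A p))"
  proof (rule card_form_pairs_sum)
    fix k B assume k: "k \<in> {..<2 * m}"
    show "card (form_pairs B) \<le> card (form_pairs (\<lambda>p. B p + (\<Sum>i<k. (b i k - a i k) * wedge i k p)))"
    proof (rule card_form_pairs_sum)
      fix i B assume "i \<in> {..<k}"
      then show "card (form_pairs B) \<le> card (form_pairs (\<lambda>p. B p + (b i k - a i k) * wedge i k p))"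
        using cong_isometry_wedge[of i k m j "b i k - a i k"] k j card_form_pairs_isometry by auto
    qed simp
  qed simp
  also have "form_pairs (\<lambda>p. B p + ?A p) = form_pairs C"
  proof (rule img_pairs_cong)
    fix Z W
    have "B (x, y) + ?A (x, y) = C (x, y)" if "x \<in> U" "y \<in> U" for x y
      using a b that by (simp add: left_diff_distrib sum_subtractf)
    then show "(R Z W \<and> (\<forall>x\<in>U. \<forall>y\<in>U. contact_form m j Z W (x, y) = B (x, y) + ?A (x, y))) =
        (R Z W \<and> (\<forall>x\<in>U. \<forall>y\<in>U. contact_form m j Z W (x, y) = C (x, y)))" by simp
  qed
  finally show ?thesis .
qed

end

section \<open>Equidistribution of the contact form among alternating forms\<close>

lemma finite_alternating_forms:
  fixes U :: "(nat \<Rightarrow> 'a :: {finite, field}) set"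
  assumes "finite U"
  shows "finite (alternating_forms U)"
proof (rule finite_subset)
  show "alternating_forms U \<subseteq> (U \<times> U) \<rightarrow>\<^sub>E UNIV" by (auto simp: alternating_forms_def PiE_def)
  show "finite ((U \<times> U) \<rightarrow>\<^sub>E (UNIV :: 'a set))" using assms by (intro finite_PiE) auto
qed

lemma alternating_forms_nonempty:
  assumes "fmod.subspace U"
  shows "alternating_forms U \<noteq> {}"
proof -
  have "restrict (\<lambda>_. 0) (U \<times> U) \<in> alternating_forms U"
    unfolding alternating_forms_def
    by (simp add: fmod.subspace_add[OF assms] fmod.subspace_scale[OF assms])
  then show ?thesis by blast
qed

text \<open>The pairs satisfying \<open>R\<close> split into disjoint classes of equal size, one for
  each alternating form on \<open>U\<close>, and the form's kernel is the next member of the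
  sequence. \<open>R\<close> is left general so that it can be either the present state or the whole
  history.\<close>

lemma card_img_pairs_kernel:
  fixes R :: "(nat \<Rightarrow> 'p :: prime_card adic_int) set \<Rightarrow> (nat \<Rightarrow> 'p adic_int) set \<Rightarrow> bool"
  assumes j: "j \<ge> 1" and fin: "finite (image_mod m (Suc j) ` (OGr m :: (nat \<Rightarrow> 'p adic_int) set set))"
    and R_cong: "\<And>Z W W'. Z \<in> OGr m \<Longrightarrow> W \<in> OGr m \<Longrightarrow> W' \<in> OGr m \<Longrightarrow>
      image_mod m j W = image_mod m j W' \<Longrightarrow> R Z W = R Z W'"
    and R_S: "\<And>Z W. Z \<in> OGr m \<Longrightarrow> W \<in> OGr m \<Longrightarrow> R Z W \<Longrightarrow> S_seq m Z W j = U"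
  shows "card (img_pairs m (Suc j) (\<lambda>Z W. R Z W \<and> T (S_seq m Z W (Suc j)))) * card (alternating_forms U)
    = card {B \<in> alternating_forms U. T (form_kernel U B)} * card (img_pairs m (Suc j) R)"
proof (cases "\<exists>Z\<in>OGr m. \<exists>W\<in>OGr m. R Z W")
  case False
  then have "img_pairs m (Suc j) R = {}"
    "img_pairs m (Suc j) (\<lambda>Z W. R Z W \<and> T (S_seq m Z W (Suc j))) = {}"
    unfolding img_pairs_def by blast+
  then show ?thesis by simp
next
  case True
  then obtain Z0 W0 where ZW0: "Z0 \<in> OGr m" "W0 \<in> OGr m" "R Z0 W0" by blast
  then have U_eq: "U = fst ` contact_rel m j Z0 W0"
    using R_S S_seq_eq_contact_rel[OF j] by metis
  have U: "fmod.subspace U" "U \<subseteq> V_mod m"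
    unfolding U_eq using subspace_contact_rel_domain[OF ZW0(1,2)] contact_rel_subset[OF ZW0(1,2), of j]
    by auto
  then have finU: "finite U" by (intro finite_subset[OF _ finite_coord_space])
  define F where "F B = img_pairs m (Suc j)
    (\<lambda>Z W. R Z W \<and> (\<forall>x\<in>U. \<forall>y\<in>U. contact_form m j Z W (x, y) = B (x, y)))" for B
  obtain B0 where B0: "B0 \<in> alternating_forms U" using alternating_forms_nonempty[OF U(1)] by blast
  have card_F: "card (F B) = card (F B0)" if "B \<in> alternating_forms U" for B
  proof (rule antisym)
    show "card (F B) \<le> card (F B0)"
      unfolding F_def by (rule card_form_pairs_le[OF j fin R_cong R_S U that B0])
    show "card (F B0) \<le> card (F B)"
      unfolding F_def by (rule card_form_pairs_le[OF j fin R_cong R_S U B0 that])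
  qed
  have disj: "F B \<inter> F C = {}" if BC: "B \<in> alternating_forms U" "C \<in> alternating_forms U" "B \<noteq> C" for B C
  proof (rule ccontr)
    assume "F B \<inter> F C \<noteq> {}"
    then obtain Z W Z' W' where eq: "image_mod m (Suc j) Z = image_mod m (Suc j) Z'"
        "image_mod m (Suc j) W = image_mod m (Suc j) W'"
        and B: "\<forall>x\<in>U. \<forall>y\<in>U. contact_form m j Z W (x, y) = B (x, y)"
        and C: "\<forall>x\<in>U. \<forall>y\<in>U. contact_form m j Z' W' (x, y) = C (x, y)"
      unfolding F_def img_pairs_def by blast
    \<comment> \<open>Reductions at level \<open>Suc j\<close> determine the contact form, so a
      common pair would force \<open>B\<close> and \<open>C\<close> to agree on
      \<open>U\<close>.\<close>
    have "contact_form m j Z W = contact_form m j Z' W'"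
      unfolding contact_form_def contact_rel_cong_image_mod[OF eq] ..
    then have "B p = C p" if "p \<in> U \<times> U" for p using that B C by auto
    moreover have "B \<in> extensional (U \<times> U)" "C \<in> extensional (U \<times> U)"
      using BC by (auto simp: alternating_forms_def)
    ultimately have "B = C" by (intro extensionalityI)
    then show False using BC by simp
  qed
  have count: "card (img_pairs m (Suc j) (\<lambda>Z W. R Z W \<and> T (S_seq m Z W (Suc j))))
      = card {B \<in> alternating_forms U. T (form_kernel U B)} * card (F B0)" for T
  proof -
    let ?S = "{B \<in> alternating_forms U. T (form_kernel U B)}"
    have "img_pairs m (Suc j) (\<lambda>Z W. R Z W \<and> T (S_seq m Z W (Suc j))) = (\<Union>B\<in>?S. F B)"
    proof (intro equalityI subsetI)
      fix q assume "q \<in> img_pairs m (Suc j) (\<lambda>Z W. R Z W \<and> T (S_seq m Z W (Suc j)))"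
      then obtain Z W where q: "q = (image_mod m (Suc j) Z, image_mod m (Suc j) W)"
          and ZW: "Z \<in> OGr m" "W \<in> OGr m" "R Z W" and T: "T (S_seq m Z W (Suc j))"
        unfolding img_pairs_def by blast
      let ?B = "restrict (contact_form m j Z W) (U \<times> U)"
      have "?B \<in> ?S"
        using contact_form_alternating[OF ZW(1,2) j] form_kernel_contact_form[OF ZW(1,2) j] T
        unfolding R_S[OF ZW] by simp
      moreover have "q \<in> F ?B" unfolding F_def img_pairs_def q using ZW by auto
      ultimately show "q \<in> (\<Union>B\<in>?S. F B)" by blast
    next
      fix q assume "q \<in> (\<Union>B\<in>?S. F B)"
      then obtain B where B: "B \<in> ?S" "q \<in> F B" by blast
      then obtain Z W where q: "q = (image_mod m (Suc j) Z, image_mod m (Suc j) W)"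
          and ZW: "Z \<in> OGr m" "W \<in> OGr m" "R Z W"
          and BU: "\<forall>x\<in>U. \<forall>y\<in>U. contact_form m j Z W (x, y) = B (x, y)"
        unfolding F_def img_pairs_def by blast
      have "form_kernel U B = form_kernel U (restrict (contact_form m j Z W) (U \<times> U))"
        using BU by (auto simp: form_kernel_def)
      also have "\<dots> = S_seq m Z W (Suc j)"
        using form_kernel_contact_form[OF ZW(1,2) j] unfolding R_S[OF ZW] .
      finally show "q \<in> img_pairs m (Suc j) (\<lambda>Z W. R Z W \<and> T (S_seq m Z W (Suc j)))"
        using B(1) ZW unfolding img_pairs_def q by auto
    qed
    moreover have "card (\<Union>B\<in>?S. F B) = (\<Sum>B\<in>?S. card (F B))"
    proof (rule card_UN_disjoint)
      show "finite ?S" using finite_alternating_forms[OF finU] by simp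
      show "\<forall>B\<in>?S. finite (F B)"
        unfolding F_def by (intro ballI finite_subset[OF img_pairs_subset]) (simp add: fin)
    qed (use disj in auto)
    ultimately show ?thesis using card_F by simp
  qed
  \<comment> \<open>With the trivial predicate, \<open>count\<close> expresses the number of all
    pairs through the common class size, which is then eliminated.\<close>
  from count[of T] count[of "\<lambda>_. True"] show ?thesis by simp
qed

section \<open>Probabilities\<close>

text \<open>Representatives at level \<open>Suc e\<close> are those at level \<open>e\<close> plus
  \<open>ell ^ e\<close> times lifts of the finitely many vectors over the residue field.\<close>

lemma finite_quotient_reps:
  "\<exists>F. finite F \<and> (\<forall>v\<in>V_adic m. \<exists>f\<in>F. v - f \<in> (ell_pow_V m e :: (nat \<Rightarrow> 'p :: prime_card adic_int) set))"
proof (induction e)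
  case 0
  have "v - 0 \<in> ell_pow_V m 0" if "v \<in> V_adic m" for v :: "nat \<Rightarrow> 'p adic_int"
    using that by (simp add: ell_pow_V_def)
  then show ?case by (intro exI[of _ "{0}"]) auto
next
  case (Suc e)
  then obtain F where F: "finite F" "\<And>v :: nat \<Rightarrow> 'p adic_int. v \<in> V_adic m \<Longrightarrow> \<exists>f\<in>F. v - f \<in> ell_pow_V m e"
    by blast
  define l where "l y = (\<lambda>i. of_int (to_int_mod_ring (y i)) :: 'p adic_int)" for y :: "nat \<Rightarrow> 'p mod_ring"
  have l: "red_vec (l y) = y" "y \<in> V_mod m \<Longrightarrow> l y \<in> V_adic m" for y
    by (simp_all add: l_def red_vec_def coord_space_def of_int_of_int_mod_ring)
  define F' where "F' = (\<lambda>(f, y). f + smul (ell ^ e) (l y)) ` (F \<times> V_mod m)"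
  have "\<exists>f\<in>F'. v - f \<in> ell_pow_V m (Suc e)" if v: "v \<in> V_adic m" for v
  proof -
    obtain f u where f: "f \<in> F" "u \<in> V_adic m" "v - f = smul (ell ^ e) u"
      using F(2)[OF v] by (auto simp: ell_pow_V_def)
    have y: "red_vec u \<in> V_mod m" by (rule red_vec_coord_space[OF f(2)])
    obtain r where r: "r \<in> V_adic m" "u - l (red_vec u) = smul ell r"
      using red_vec_eq_0_imp[of "u - l (red_vec u)" "2 * m"] coord_space_closed(3)[OF f(2) l(2)[OF y]]
      by (auto simp: l(1))
    have "v - (f + smul (ell ^ e) (l (red_vec u))) = (v - f) - smul (ell ^ e) (l (red_vec u))" by simp
    also have "\<dots> = smul (ell ^ e) (u - l (red_vec u))"
      unfolding f(3) by (simp only: fmod.scale_right_diff_distrib)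
    also have "\<dots> = smul (ell ^ Suc e) r" by (simp add: r(2) mult.commute)
    finally have "v - (f + smul (ell ^ e) (l (red_vec u))) \<in> ell_pow_V m (Suc e)"
      unfolding ell_pow_V_def using r(1) by (rule image_eqI)
    moreover have "f + smul (ell ^ e) (l (red_vec u)) \<in> F'" using f(1) y by (force simp: F'_def)
    ultimately show ?thesis by blast
  qed
  moreover have "finite F'" 
    unfolding F'_def using F(1) by (intro finite_imageI finite_cartesian_product finite_coord_space)
  ultimately show ?case by blast
qed

lemma finite_image_mod_OGr: "finite (image_mod m e ` (OGr m :: (nat \<Rightarrow> 'p :: prime_card adic_int) set set))"
proof -
  obtain F where F: "finite F" "\<And>v :: nat \<Rightarrow> 'p adic_int. v \<in> V_adic m \<Longrightarrow> \<exists>f\<in>F. v - f \<in> ell_pow_V m e"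
    using finite_quotient_reps[of m e, where 'p = 'p] by blast
  have "image_mod m e Z \<subseteq> (\<lambda>f. f +o ell_pow_V m e) ` F" if "Z \<in> OGr m" for Z
  proof -
    have "\<forall>v\<in>Z. \<exists>f\<in>F. v - f \<in> ell_pow_V m e" using F(2) OGr_subset[OF that] by (meson subsetD)
    then show ?thesis using image_mod_subset_iff[of m e Z F] by (simp only: image_mod_def)
  qed
  then have "image_mod m e ` OGr m \<subseteq> Pow ((\<lambda>f. f +o ell_pow_V m e) ` F)" by blast
  then show ?thesis by (rule finite_subset) (simp add: F(1))
qed

lemma S_seq_cong:
  "image_mod m j Z = image_mod m j Z' \<Longrightarrow> image_mod m j W = image_mod m j W' \<Longrightarrow> S_seq m Z W j = S_seq m Z' W' j"
  by (simp add: S_seq_def)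

section \<open>From counting reductions to probabilities of the random pair\<close>

context
  fixes m :: nat and M :: "(nat \<Rightarrow> 'p :: prime_card adic_int) set measure"
  assumes M: "canonical_OGr_measure m M"
begin

lemma space_canonical: "space M = OGr m"
proof -
  have "sets M = sets (OGr_borel m)" using M by (simp add: canonical_OGr_measure_def)
  then have "space M = space (OGr_borel m)" by (rule sets_eq_imp_space_eq)
  also have "\<dots> = OGr m" unfolding OGr_borel_def by (rule space_measure_of) auto
  finally show ?thesis .
qed

lemma fibre_in_sets_canonical: "e \<ge> 1 \<Longrightarrow> {Z \<in> OGr m. image_mod m e Z = X} \<in> sets M"
proof -
  assume "e \<ge> 1"
  then have "{Z \<in> OGr m. image_mod m e Z = X} \<in> sets (OGr_borel m :: (nat \<Rightarrow> 'p adic_int) set measure)"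
    unfolding OGr_borel_def by (subst sets_measure_of) auto
  then show ?thesis using M by (simp add: canonical_OGr_measure_def)
qed

lemma measure_fibre_canonical:
  assumes e: "e \<ge> 1" and X: "X \<in> image_mod m e ` OGr m"
  shows "measure M {Z \<in> OGr m. image_mod m e Z = X} = 1 / card (image_mod m e ` (OGr m :: (nat \<Rightarrow> 'p adic_int) set set))"
proof -
  let ?I = "image_mod m e ` (OGr m :: (nat \<Rightarrow> 'p adic_int) set set)"
  have fibre: "image_mod m e -` {X} \<inter> space M = {Z \<in> OGr m. image_mod m e Z = X}" for X
    by (auto simp: space_canonical)
  have "image_mod m e \<in> measurable M (count_space ?I)"
    unfolding measurable_count_space_eq2[OF finite_image_mod_OGr] fibre
    using fibre_in_sets_canonical[OF e] by (simp add: space_canonical)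
  then have "measure M {Z \<in> OGr m. image_mod m e Z = X} = measure (distr M (count_space ?I) (image_mod m e)) {X}"
    using X by (simp add: measure_distr fibre)
  also have "\<dots> = measure (uniform_count_measure ?I) {X}"
    using M e by (simp add: canonical_OGr_measure_def)
  also have "\<dots> = 1 / card ?I"
    using X measure_uniform_count_measure[OF finite_image_mod_OGr, of "{X}" m e] by simp
  finally show ?thesis .
qed

context
  fixes P :: "'w measure" and Z W :: "'w \<Rightarrow> (nat \<Rightarrow> 'p adic_int) set"
  assumes P: "prob_space P" and indep: "prob_space.indep_var P M Z M W"
    and distr_Z: "distr P M Z = M" and distr_W: "distr P M W = M"
begin

interpretation P: prob_space P by (rule P)

lemma Z_measurable: "Z \<in> measurable P M" and W_measurable: "W \<in> measurable P M"
  using P.indep_var_rv1[OF indep] P.indep_var_rv2[OF indep] .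

lemma Z_OGr: "\<omega> \<in> space P \<Longrightarrow> Z \<omega> \<in> OGr m" and W_OGr: "\<omega> \<in> space P \<Longrightarrow> W \<omega> \<in> OGr m"
  using measurable_space[OF Z_measurable] measurable_space[OF W_measurable] by (simp_all add: space_canonical)

definition pair_event :: "nat \<Rightarrow> (nat \<Rightarrow> 'p adic_int) set set \<times> (nat \<Rightarrow> 'p adic_int) set set \<Rightarrow> 'w set" where
  "pair_event e q = {\<omega> \<in> space P. image_mod m e (Z \<omega>) = fst q \<and> image_mod m e (W \<omega>) = snd q}"

text \<open>Independence multiplies two uniform probabilities, so all pairs of reductions are
  equally likely.\<close>

lemma measure_pair_event:
  assumes e: "e \<ge> 1"
  shows "pair_event e q \<in> sets P"
    and "q \<in> image_mod m e ` OGr m \<times> image_mod m e ` OGr m \<Longrightarrow>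
      measure P (pair_event e q) = (1 / card (image_mod m e ` (OGr m :: (nat \<Rightarrow> 'p adic_int) set set)))\<^sup>2"
proof -
  define A where "A X = {Z \<in> OGr m. image_mod m e Z = X}" for X :: "(nat \<Rightarrow> 'p adic_int) set set"
  have A: "A X \<in> sets M" for X unfolding A_def by (rule fibre_in_sets_canonical[OF e])
  have eq: "pair_event e q = (Z -` A (fst q) \<inter> space P) \<inter> (W -` A (snd q) \<inter> space P)"
    using Z_OGr W_OGr by (auto simp: pair_event_def A_def)
  show "pair_event e q \<in> sets P"
    unfolding eq using measurable_sets[OF Z_measurable A] measurable_sets[OF W_measurable A] by (rule sets.Int)
  assume q: "q \<in> image_mod m e ` OGr m \<times> image_mod m e ` OGr m"
  have "measure P (pair_event e q) = measure P ((\<lambda>\<omega>. (Z \<omega>, W \<omega>)) -` (A (fst q) \<times> A (snd q)) \<inter> space P)"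
    unfolding eq by (rule arg_cong[of _ _ "measure P"]) auto
  also have "\<dots> = measure P (Z -` A (fst q) \<inter> space P) * measure P (W -` A (snd q) \<inter> space P)"
    by (rule P.indep_varD[OF indep A A])
  also have "\<dots> = measure M (A (fst q)) * measure M (A (snd q))"
    using measure_distr[OF Z_measurable A] measure_distr[OF W_measurable A] by (simp add: distr_Z distr_W)
  also have "\<dots> = (1 / card (image_mod m e ` (OGr m :: (nat \<Rightarrow> 'p adic_int) set set)))\<^sup>2"
    using q measure_fibre_canonical[OF e] by (auto simp: A_def power2_eq_square)
  finally show "measure P (pair_event e q) = (1 / card (image_mod m e ` (OGr m :: (nat \<Rightarrow> 'p adic_int) set set)))\<^sup>2" .
qed

text \<open>Such an event is a finite disjoint union of equally likely \<open>pair_event\<close>s,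
  so its probability is a count.\<close>

lemma event_determined_by_images:
  assumes e: "e \<ge> 1"
    and R_cong: "\<And>X Y X' Y'. \<lbrakk>X \<in> OGr m; Y \<in> OGr m; X' \<in> OGr m; Y' \<in> OGr m;
      image_mod m e X = image_mod m e X'; image_mod m e Y = image_mod m e Y'; R X Y\<rbrakk> \<Longrightarrow> R X' Y'"
  shows "{\<omega> \<in> space P. R (Z \<omega>) (W \<omega>)} \<in> sets P"
    and "\<P>(\<omega> in P. R (Z \<omega>) (W \<omega>)) = card (img_pairs m e R) *
      (1 / card (image_mod m e ` (OGr m :: (nat \<Rightarrow> 'p adic_int) set set)))\<^sup>2"
proof -
  have fin: "finite (img_pairs m e R)"
    by (rule finite_subset[OF img_pairs_subset]) (simp add: finite_image_mod_OGr)
  have eq: "{\<omega> \<in> space P. R (Z \<omega>) (W \<omega>)} = (\<Union>q\<in>img_pairs m e R. pair_event e q)"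
  proof (intro equalityI subsetI)
    fix \<omega> assume "\<omega> \<in> {\<omega> \<in> space P. R (Z \<omega>) (W \<omega>)}"
    then have w: "\<omega> \<in> space P" "R (Z \<omega>) (W \<omega>)" by auto
    let ?q = "(image_mod m e (Z \<omega>), image_mod m e (W \<omega>))"
    have "?q \<in> img_pairs m e R" unfolding img_pairs_def using Z_OGr[OF w(1)] W_OGr[OF w(1)] w(2) by blast
    moreover have "\<omega> \<in> pair_event e ?q" using w(1) by (simp add: pair_event_def)
    ultimately show "\<omega> \<in> (\<Union>q\<in>img_pairs m e R. pair_event e q)" by blast
  next
    fix \<omega> assume "\<omega> \<in> (\<Union>q\<in>img_pairs m e R. pair_event e q)"
    then obtain X Y where XY: "X \<in> OGr m" "Y \<in> OGr m" "R X Y" and w: "\<omega> \<in> space P"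
        "image_mod m e (Z \<omega>) = image_mod m e X" "image_mod m e (W \<omega>) = image_mod m e Y"
      by (auto simp: pair_event_def img_pairs_def)
    then show "\<omega> \<in> {\<omega> \<in> space P. R (Z \<omega>) (W \<omega>)}"
      using R_cong[OF XY(1,2) Z_OGr[OF w(1)] W_OGr[OF w(1)]] by simp
  qed
  show "{\<omega> \<in> space P. R (Z \<omega>) (W \<omega>)} \<in> sets P"
    unfolding eq using fin measure_pair_event(1)[OF e] by (intro sets.finite_UN) auto
  have "\<P>(\<omega> in P. R (Z \<omega>) (W \<omega>)) = (\<Sum>q\<in>img_pairs m e R. measure P (pair_event e q))"
    unfolding eq
    by (rule P.finite_measure_finite_Union[OF fin])
      (use measure_pair_event(1)[OF e] in \<open>auto simp: disjoint_family_on_def pair_event_def\<close>)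
  also have "\<dots> = (\<Sum>q\<in>img_pairs m e R. (1 / card (image_mod m e ` (OGr m :: (nat \<Rightarrow> 'p adic_int) set set)))\<^sup>2)"
    using img_pairs_subset by (intro sum.cong measure_pair_event(2)[OF e]) blast+
  finally show "\<P>(\<omega> in P. R (Z \<omega>) (W \<omega>)) = card (img_pairs m e R) *
      (1 / card (image_mod m e ` (OGr m :: (nat \<Rightarrow> 'p adic_int) set set)))\<^sup>2" by simp
qed

text \<open>Both events are determined at level \<open>Suc j\<close>, where their probabilities are
  counts with the same normalising factor \<open>?c\<close>; the ratio of the counts is
  \<open>card_img_pairs_kernel\<close>.\<close>

lemma prob_kernel:
  assumes j: "j \<ge> 1"
    and R_cong: "\<And>X Y X' Y'. \<lbrakk>X \<in> OGr m; Y \<in> OGr m; X' \<in> OGr m; Y' \<in> OGr m;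
      image_mod m j X = image_mod m j X'; image_mod m j Y = image_mod m j Y'; R X Y\<rbrakk> \<Longrightarrow> R X' Y'"
    and R_S: "\<And>X Y. R X Y \<Longrightarrow> S_seq m X Y j = U"
  shows "\<P>(\<omega> in P. T (S_seq m (Z \<omega>) (W \<omega>) (Suc j)) \<and> R (Z \<omega>) (W \<omega>))
    = measure (pmf_of_set (alternating_forms U)) {B. T (form_kernel U B)} * \<P>(\<omega> in P. R (Z \<omega>) (W \<omega>))"
proof (cases "\<exists>\<omega>\<in>space P. R (Z \<omega>) (W \<omega>)")
  \<comment> \<open>If \<open>R\<close> never occurs, nothing is known about \<open>U\<close>, and
    \<open>pmf_of_set\<close> may be unspecified; both sides are 0 all the same.\<close>
  case False
  then have "{\<omega> \<in> space P. R (Z \<omega>) (W \<omega>)} = {}"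
    "{\<omega> \<in> space P. T (S_seq m (Z \<omega>) (W \<omega>) (Suc j)) \<and> R (Z \<omega>) (W \<omega>)} = {}" by blast+
  then show ?thesis by (simp only: measure_empty mult_zero_right)
next
  case True
  then obtain \<omega> where w: "\<omega> \<in> space P" "R (Z \<omega>) (W \<omega>)" by blast
  note OGr = Z_OGr[OF w(1)] W_OGr[OF w(1)]
  have U_eq: "U = fst ` contact_rel m j (Z \<omega>) (W \<omega>)"
    using R_S[OF w(2)] S_seq_eq_contact_rel[OF j] by metis
  have "finite U" unfolding U_eq using finite_contact_rel[OF OGr] by (rule finite_imageI)
  then have fin: "finite (alternating_forms U)" by (rule finite_alternating_forms)
  have ne: "alternating_forms U \<noteq> {}"
    unfolding U_eq by (intro alternating_forms_nonempty subspace_contact_rel_domain OGr)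
  let ?R = "\<lambda>X Y. R X Y \<and> T (S_seq m X Y (Suc j))"
  have R_cong': "R X' Y'"
    if "X \<in> OGr m" "Y \<in> OGr m" "X' \<in> OGr m" "Y' \<in> OGr m"
      "image_mod m (Suc j) X = image_mod m (Suc j) X'" "image_mod m (Suc j) Y = image_mod m (Suc j) Y'" "R X Y"
    for X Y X' Y'
    using R_cong[OF that(1-4) _ _ that(7)] image_mod_mono_level[OF that(5), of j]
      image_mod_mono_level[OF that(6), of j] by simp
  have T_cong': "?R X' Y'"
    if "X \<in> OGr m" "Y \<in> OGr m" "X' \<in> OGr m" "Y' \<in> OGr m"
      "image_mod m (Suc j) X = image_mod m (Suc j) X'" "image_mod m (Suc j) Y = image_mod m (Suc j) Y'" "?R X Y"
    for X Y X' Y'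
    using R_cong'[OF that(1-6)] S_seq_cong[OF that(5,6)] that(7) by simp
  let ?c = "(1 / card (image_mod m (Suc j) ` (OGr m :: (nat \<Rightarrow> 'p adic_int) set set)))\<^sup>2"
  have "card (img_pairs m (Suc j) ?R) * card (alternating_forms U)
    = card {B \<in> alternating_forms U. T (form_kernel U B)} * card (img_pairs m (Suc j) R)"
  proof (rule card_img_pairs_kernel[OF j finite_image_mod_OGr])
    fix X Y Y' :: "(nat \<Rightarrow> 'p adic_int) set"
    assume *: "X \<in> OGr m" "Y \<in> OGr m" "Y' \<in> OGr m" "image_mod m j Y = image_mod m j Y'"
    show "R X Y = R X Y'"
      using R_cong[OF *(1,2,1,3) refl *(4)] R_cong[OF *(1,3,1,2) refl *(4)[symmetric]] by blast
  qed (rule R_S)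
  then have "real (card (img_pairs m (Suc j) ?R)) * card (alternating_forms U)
    = real (card {B \<in> alternating_forms U. T (form_kernel U B)}) * card (img_pairs m (Suc j) R)"
    by (simp only: of_nat_mult[symmetric])
  moreover have "card (alternating_forms U) > 0" using fin ne by (simp add: card_gt_0_iff)
  ultimately have "real (card (img_pairs m (Suc j) ?R))
      = measure (pmf_of_set (alternating_forms U)) {B. T (form_kernel U B)} * card (img_pairs m (Suc j) R)"
    unfolding measure_pmf_of_set[OF ne fin] by (simp add: field_simps Int_def)
  moreover have "\<P>(\<omega> in P. R (Z \<omega>) (W \<omega>)) = card (img_pairs m (Suc j) R) * ?c"
    by (rule event_determined_by_images(2)) (simp, rule R_cong')
  moreover have "\<P>(\<omega> in P. ?R (Z \<omega>) (W \<omega>)) = card (img_pairs m (Suc j) ?R) * ?c"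
    by (rule event_determined_by_images(2)) (simp, rule T_cong')
  ultimately show ?thesis by (simp add: conj_commute)
qed

text \<open>The right-hand side depends on the condition \<open>R\<close> only through
  \<open>U\<close>, which is the source of the Markov property.\<close>

lemma cond_prob_kernel:
  assumes "j \<ge> 1"
    and "\<And>X Y X' Y'. \<lbrakk>X \<in> OGr m; Y \<in> OGr m; X' \<in> OGr m; Y' \<in> OGr m;
      image_mod m j X = image_mod m j X'; image_mod m j Y = image_mod m j Y'; R X Y\<rbrakk> \<Longrightarrow> R X' Y'"
    and "\<And>X Y. R X Y \<Longrightarrow> S_seq m X Y j = U"
    and "\<P>(\<omega> in P. R (Z \<omega>) (W \<omega>)) > 0"
  shows "\<P>(\<omega> in P. T (S_seq m (Z \<omega>) (W \<omega>) (Suc j)) \<bar> R (Z \<omega>) (W \<omega>))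
    = measure (pmf_of_set (alternating_forms U)) {B. T (form_kernel U B)}"
proof -
  have "\<P>(\<omega> in P. T (S_seq m (Z \<omega>) (W \<omega>) (Suc j)) \<and> R (Z \<omega>) (W \<omega>))
      = measure (pmf_of_set (alternating_forms U)) {B. T (form_kernel U B)} * \<P>(\<omega> in P. R (Z \<omega>) (W \<omega>))"
    by (rule prob_kernel[OF assms(1-3)])
  then show ?thesis using assms(4) by (simp add: cond_prob_def)
qed

section \<open>The Markov property and the law of the dimension\<close>

lemma S_seq_measurable: "(\<lambda>\<omega>. S_seq m (Z \<omega>) (W \<omega>) (Suc n)) \<in> measurable P (count_space (Pow (V_mod m)))"
proof -
  have "S_seq m (Z \<omega>) (W \<omega>) (Suc n) \<subseteq> V_mod m" if "\<omega> \<in> space P" for \<omega>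
    using contact_rel_subset[OF Z_OGr[OF that] W_OGr[OF that], of "Suc n"]
    by (subst S_seq_eq_contact_rel) auto
  moreover have "{\<omega> \<in> space P. S_seq m (Z \<omega>) (W \<omega>) (Suc n) = S} \<in> sets P" for S
    by (rule event_determined_by_images(1)[of "Suc n"]) (simp, simp add: S_seq_def)
  moreover have "(\<lambda>\<omega>. S_seq m (Z \<omega>) (W \<omega>) (Suc n)) -` {S} \<inter> space P
      = {\<omega> \<in> space P. S_seq m (Z \<omega>) (W \<omega>) (Suc n) = S}" for S by auto
  ultimately show ?thesis
    by (subst measurable_count_space_eq2) (auto simp: finite_coord_space)
qed

text \<open>Conditioning on the history and on the present state alone both give the probability
  that a random alternating form on \<open>s n\<close> has kernel \<open>s (Suc n)\<close>. The
  index shift starts the chain at level 1.\<close>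

lemma S_seq_markov: "markov_sequence P (Pow (V_mod m)) (\<lambda>n \<omega>. S_seq m (Z \<omega>) (W \<omega>) (Suc n))"
  unfolding markov_sequence_def
proof (intro conjI allI impI S_seq_measurable)
  show "countable (Pow (V_mod m :: (nat \<Rightarrow> 'p mod_ring) set))"
    by (rule countable_finite) (simp add: finite_coord_space)
  fix n and s :: "nat \<Rightarrow> (nat \<Rightarrow> 'p mod_ring) set"
  assume pos: "\<P>(\<omega> in P. \<forall>k\<le>n. S_seq m (Z \<omega>) (W \<omega>) (Suc k) = s k) > 0"
  have cong1: "\<forall>k\<le>n. S_seq m X' Y' (Suc k) = s k"
    if "image_mod m (Suc n) X = image_mod m (Suc n) X'" "image_mod m (Suc n) Y = image_mod m (Suc n) Y'"
      "\<forall>k\<le>n. S_seq m X Y (Suc k) = s k" for X Y X' Y'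
  proof (intro allI impI)
    fix k assume k: "k \<le> n"
    have "S_seq m X Y (Suc k) = S_seq m X' Y' (Suc k)"
      using image_mod_mono_level[OF that(1), of "Suc k"] image_mod_mono_level[OF that(2), of "Suc k"] k
      by (intro S_seq_cong) simp_all
    then show "S_seq m X' Y' (Suc k) = s k" using that(3) k by simp
  qed
  have cong2: "S_seq m X' Y' (Suc n) = s n"
    if "image_mod m (Suc n) X = image_mod m (Suc n) X'" "image_mod m (Suc n) Y = image_mod m (Suc n) Y'"
      "S_seq m X Y (Suc n) = s n" for X Y X' Y'
    using that by (simp add: S_seq_def)
  \<comment> \<open>The history event is contained in the present-state event, so the latter also
    has positive probability and may be conditioned on.\<close>
  have "\<P>(\<omega> in P. \<forall>k\<le>n. S_seq m (Z \<omega>) (W \<omega>) (Suc k) = s k) \<le> \<P>(\<omega> in P. S_seq m (Z \<omega>) (W \<omega>) (Suc n) = s n)"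
  proof (rule P.finite_measure_mono)
    show "{\<omega> \<in> space P. S_seq m (Z \<omega>) (W \<omega>) (Suc n) = s n} \<in> sets P"
      by (rule event_determined_by_images(1)[of "Suc n" "\<lambda>X Y. S_seq m X Y (Suc n) = s n"]) (simp, rule cong2)
  qed auto
  then have pos': "\<P>(\<omega> in P. S_seq m (Z \<omega>) (W \<omega>) (Suc n) = s n) > 0" using pos by linarith
  have "\<P>(\<omega> in P. S_seq m (Z \<omega>) (W \<omega>) (Suc (Suc n)) = s (Suc n) \<bar> \<forall>k\<le>n. S_seq m (Z \<omega>) (W \<omega>) (Suc k) = s k)
      = measure (pmf_of_set (alternating_forms (s n))) {B. form_kernel (s n) B = s (Suc n)}"
    by (rule cond_prob_kernel[where T = "\<lambda>S. S = s (Suc n)" and R = "\<lambda>X Y. \<forall>k\<le>n. S_seq m X Y (Suc k) = s k"])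
      (simp, rule cong1, assumption+, simp, rule pos)
  also have "\<dots> = \<P>(\<omega> in P. S_seq m (Z \<omega>) (W \<omega>) (Suc (Suc n)) = s (Suc n) \<bar> S_seq m (Z \<omega>) (W \<omega>) (Suc n) = s n)"
    by (rule cond_prob_kernel[symmetric, where T = "\<lambda>S. S = s (Suc n)" and R = "\<lambda>X Y. S_seq m X Y (Suc n) = s n"])
      (simp, rule cong2, assumption+, rule pos')
  finally show "\<P>(\<omega> in P. S_seq m (Z \<omega>) (W \<omega>) (Suc (Suc n)) = s (Suc n) \<bar> \<forall>k\<le>n. S_seq m (Z \<omega>) (W \<omega>) (Suc k) = s k)
      = \<P>(\<omega> in P. S_seq m (Z \<omega>) (W \<omega>) (Suc (Suc n)) = s (Suc n) \<bar> S_seq m (Z \<omega>) (W \<omega>) (Suc n) = s n)" .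
qed

lemma S_seq_dim_distribution:
  assumes "i \<ge> 1" and pos: "\<P>(\<omega> in P. S_seq m (Z \<omega>) (W \<omega>) i = U) > 0"
  shows "\<P>(\<omega> in P. fvec.dim (S_seq m (Z \<omega>) (W \<omega>) (i + 1)) = k \<bar> S_seq m (Z \<omega>) (W \<omega>) i = U)
    = pmf (map_pmf (\<lambda>B. fvec.dim (form_kernel U B)) (pmf_of_set (alternating_forms U))) k"
proof -
  have cong: "S_seq m X' Y' i = U"
    if "image_mod m i X = image_mod m i X'" "image_mod m i Y = image_mod m i Y'" "S_seq m X Y i = U" for X Y X' Y'
    using S_seq_cong[OF that(1,2)] that(3) by simp
  have "\<P>(\<omega> in P. fvec.dim (S_seq m (Z \<omega>) (W \<omega>) (Suc i)) = k \<bar> S_seq m (Z \<omega>) (W \<omega>) i = U)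
      = measure (pmf_of_set (alternating_forms U)) {B. fvec.dim (form_kernel U B) = k}"
    by (rule cond_prob_kernel[where T = "\<lambda>S. fvec.dim S = k" and R = "\<lambda>X Y. S_seq m X Y i = U"])
      (rule assms(1), rule cong, assumption+, rule pos)
  then show ?thesis by (simp add: pmf_map vimage_def)
qed

end

end

theorem theorem5p13:
  fixes m :: nat
    and M :: "(nat \<Rightarrow> 'p :: prime_card adic_int) set measure"
    and P :: "'w measure"
    and Z W :: "'w \<Rightarrow> (nat \<Rightarrow> 'p adic_int) set"
  assumes "canonical_OGr_measure m M"
    and "prob_space P"
    and "prob_space.indep_var P M Z M W"
    and "distr P M Z = M"
    and "distr P M W = M"
  shows "markov_sequence P (Pow (V_mod m)) (\<lambda>n \<omega>. S_seq m (Z \<omega>) (W \<omega>) (Suc n)) \<and>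
    (\<forall>i\<ge>1. \<forall>U. \<P>(\<omega> in P. S_seq m (Z \<omega>) (W \<omega>) i = U) > 0 \<longrightarrow>
       (\<forall>k. \<P>(\<omega> in P. fvec.dim (S_seq m (Z \<omega>) (W \<omega>) (i + 1)) = k \<bar> S_seq m (Z \<omega>) (W \<omega>) i = U)
         = pmf (map_pmf (\<lambda>B. fvec.dim (form_kernel U B)) (pmf_of_set (alternating_forms U))) k))"
  using S_seq_markov[OF assms] S_seq_dim_distribution[OF assms] by blast

end
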